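(* Let $k,m\ge1$ and $\mathbf{y},\mathbf{z}\in\mathbb{Z}_{\ge0}^k$. Then the skew Gelfand–Tsetlin polytope $\mathcal{GT}_k^m(\mathbf{y},\mathbf{z})$ is Ehrhart positive.
   Context: For $\mathbf{y},\mathbf{z}\in\mathbb{Z}_{\ge0}^k$ set $\tilde y_i=y_1+\cdots+y_i$ and $\tilde z_i=z_1+\cdots+z_i$ for $i\in[k]$. The skew Gelfand–Tsetlin polytope $\mathcal{GT}_k^m(\mathbf{y},\mathbf{z})$ is the set of points $(x_{i,j})_{i\in[k],j\in[m]}\in\mathbb{R}^{km}$ satisfying $x_{i,j}\le x_{i,j+1}\le x_{i+1,j}$ (for all indices for which these variables are defined), where one sets $x_{i,0}=\tilde z_i$ and $x_{i,m+1}=\tilde y_i$ for all $i\in[k]$. It is a (possibly empty) lattice polytope. A lattice polytope $Q\subset\mathbb{R}^d$ is Ehrhart positive if its Ehrhart polynomial $E_Q(n)=|nQ\cap\mathbb{Z}^d|$ ($n\ge0$) has only nonnegative coefficients. *)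

theory Defs
  imports Complex_Main "HOL-Library.FuncSet" "HOL-Computational_Algebra.Polynomial"
begin

text \<open>
  For a finite index set \<open>I\<close>, the space of real families indexed by \<open>I\<close> is represented by the
  functions in \<open>extensional I\<close>, so that each point has exactly one representative.
\<close>

definition lattice :: "'i set \<Rightarrow> ('i \<Rightarrow> real) set" where
  "lattice I = (I \<rightarrow>\<^sub>E \<int>)"

definition dilate :: "'i set \<Rightarrow> nat \<Rightarrow> ('i \<Rightarrow> real) set \<Rightarrow> ('i \<Rightarrow> real) set" where
  "dilate I n Q = (\<lambda>x. \<lambda>i\<in>I. real n * x i) ` Q"

text \<open>
  The finiteness conjunct only excludes sets for which \<open>card\<close> would return the default value 0.
  At \<open>n = 0\<close> the count is 1 for nonempty \<open>Q\<close> and 0 for empty \<open>Q\<close>; the Ehrhart polynomial of the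
  empty polytope is thus the zero polynomial.
\<close>

definition is_ehrhart_polynomial :: "'i set \<Rightarrow> ('i \<Rightarrow> real) set \<Rightarrow> real poly \<Rightarrow> bool" where
  "is_ehrhart_polynomial I Q E \<longleftrightarrow>
     (\<forall>n::nat. finite (dilate I n Q \<inter> lattice I) \<and>
               poly E (real n) = real (card (dilate I n Q \<inter> lattice I)))"

lemma is_ehrhart_polynomial_unique:
  assumes "is_ehrhart_polynomial I Q E" and "is_ehrhart_polynomial I Q F"
  shows "E = F"
proof (rule ccontr)
  assume "E \<noteq> F"
  then have "finite {x. poly (E - F) x = 0}"
    by (intro poly_roots_finite) simp
  moreover have "range real \<subseteq> {x. poly (E - F) x = 0}"
    using assms by (auto simp: is_ehrhart_polynomial_def)
  ultimately have "finite (range real)"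
    by (rule rev_finite_subset)
  then show False
    using finite_imageD[of real UNIV] by (simp add: inj_on_def)
qed

text \<open>
  For lattice polytopes the Ehrhart polynomial exists by Ehrhart's theorem; here its existence is
  part of the property.
\<close>

definition ehrhart_positive :: "'i set \<Rightarrow> ('i \<Rightarrow> real) set \<Rightarrow> bool" where
  "ehrhart_positive I Q \<longleftrightarrow>
     (\<exists>E. is_ehrhart_polynomial I Q E \<and> (\<forall>d. coeff E d \<ge> 0))"

text \<open>
  A vector of nonnegative integers of length \<open>k\<close> is a function \<open>nat \<Rightarrow> nat\<close> of which only the
  values at \<open>1, \<dots>, k\<close> are used.
\<close>

definition partial_sum :: "(nat \<Rightarrow> nat) \<Rightarrow> nat \<Rightarrow> nat" where
  "partial_sum y i = (\<Sum>l=1..i. y l)"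

definition gt_index :: "nat \<Rightarrow> nat \<Rightarrow> (nat \<times> nat) set" where
  "gt_index k m = {1..k} \<times> {1..m}"

text \<open>The array \<open>x\<close> extended by the prescribed boundary columns 0 and \<open>m + 1\<close>.\<close>

definition gt_entry ::
  "nat \<Rightarrow> (nat \<Rightarrow> nat) \<Rightarrow> (nat \<Rightarrow> nat) \<Rightarrow> (nat \<times> nat \<Rightarrow> real) \<Rightarrow> nat \<Rightarrow> nat \<Rightarrow> real" where
  "gt_entry m y z x i j =
     (if j = 0 then real (partial_sum z i)
      else if j = m + 1 then real (partial_sum y i)
      else x (i, j))"

text \<open>
  Each of the two inequalities is imposed whenever both of its own sides are defined; in particular
  the first one is also imposed in the last row \<open>i = k\<close>, where the second one is void.
\<close>

definition skew_GT ::
  "nat \<Rightarrow> nat \<Rightarrow> (nat \<Rightarrow> nat) \<Rightarrow> (nat \<Rightarrow> nat) \<Rightarrow> (nat \<times> nat \<Rightarrow> real) set" where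
  "skew_GT k m y z =
     {x \<in> extensional (gt_index k m).
        (\<forall>i\<in>{1..k}. \<forall>j\<in>{0..m}. gt_entry m y z x i j \<le> gt_entry m y z x i (j + 1)) \<and>
        (\<forall>i\<in>{1..<k}. \<forall>j\<in>{0..m}. gt_entry m y z x i (j + 1) \<le> gt_entry m y z x (i + 1) j)}"

end

(*
  Write a lattice point of a dilate as the sequence of its level sets: at height p the level set
  records, for each row, how many entries lie below p. These form a multichain in a poset of
  decreasing sequences, and inside a block of n consecutive heights the poset does not change.
  The number of points is therefore a sum of products of numbers of multichains of length n in
  intervals of posets of strictly decreasing sequences, that is, of skew shapes.

  By Kreweras these numbers are given by a determinant, polynomial in n. They satisfy
  f(s + t) = f(s) * f(t) in the incidence algebra, so f(t) = exp(t L), where L collects the linear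
  coefficients. All coefficients are nonnegative once L is, and the linear coefficient can be read
  off the determinant: it is 0 for a disconnected skew shape, and (a - 1)! (b - 1)! / (a + b - 1)!
  for a connected one with a rows and b columns.
*)

theory Submission
  imports Defs "Jordan_Normal_Form.Determinant"
begin

hide_const (open) Module.smult Lattice.lattice

section \<open>Polynomials with nonnegative coefficients\<close>

text \<open>The delicate point is the passage from one block to the next. A block of n heights has
  only n - 1 steps between its own states, and f(n - 1) may have negative coefficients even when f
  has none. What helps is that the states of a block are closed under pointwise minimum: among the
  new states above an old state there is a least one, and starting from it turns the entering step
  into a step inside the block. The exponential series is never formed. Differentiating f(s + t) =
  f(s) * f(t) at s = 0 expresses f' through f and L. Since L is zero on the diagonal, only smaller
  intervals occur, and induction applies. Of L only the sign is used: for a rows the corner entry of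
  the matrix is a rising factorial started at t - (a - 1), whose linear coefficient has the sign
  (-1)^(a - 1) of the corner cofactor. A separate obstacle is n = 0, where blocks are empty and the
  count of walks says nothing about the constant term.\<close>

definition nonneg_coeffs :: "real poly \<Rightarrow> bool" where
  "nonneg_coeffs p \<longleftrightarrow> (\<forall>d. coeff p d \<ge> 0)"

lemma nonneg_coeffs_0 [simp]: "nonneg_coeffs 0"
  and nonneg_coeffs_1 [simp]: "nonneg_coeffs 1"
  by (simp_all add: nonneg_coeffs_def)

lemma nonneg_coeffs_pCons: "0 \<le> a \<Longrightarrow> nonneg_coeffs p \<Longrightarrow> nonneg_coeffs (pCons a p)"
  by (simp add: nonneg_coeffs_def coeff_pCons split: nat.split)

lemma nonneg_coeffs_mult: "nonneg_coeffs p \<Longrightarrow> nonneg_coeffs q \<Longrightarrow> nonneg_coeffs (p * q)"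
  by (simp add: nonneg_coeffs_def coeff_mult sum_nonneg)

lemma nonneg_coeffs_smult: "0 \<le> a \<Longrightarrow> nonneg_coeffs p \<Longrightarrow> nonneg_coeffs (smult a p)"
  by (simp add: nonneg_coeffs_def)

lemma nonneg_coeffs_sum: "(\<And>i. i \<in> I \<Longrightarrow> nonneg_coeffs (f i)) \<Longrightarrow> nonneg_coeffs (sum f I)"
  by (simp add: nonneg_coeffs_def coeff_sum sum_nonneg)

text \<open>The value at 1 is the sum of the coefficients. This lets the count at dilation factor 1
  decide whether a counting polynomial vanishes.\<close>

lemma nonneg_coeffs_eq_0_iff:
  assumes "nonneg_coeffs p"
  shows "poly p 1 = 0 \<longleftrightarrow> p = 0"
proof
  assume "poly p 1 = 0"
  then have "\<forall>i\<le>degree p. coeff p i = 0"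
    using assms by (simp add: poly_altdef nonneg_coeffs_def sum_nonneg_eq_0_iff)
  then show "p = 0"
    by (metis le_refl leading_coeff_0_iff)
qed simp

lemma coeff_mult_1: "coeff (p * q) 1 = coeff p 0 * coeff q 1 + coeff p 1 * coeff q 0"
  by (simp add: coeff_mult)

lemma nonneg_coeffs_pderivI:
  assumes "0 \<le> coeff p 0" and "nonneg_coeffs (pderiv p)"
  shows "nonneg_coeffs p"
  unfolding nonneg_coeffs_def
proof
  fix d
  show "0 \<le> coeff p d"
  proof (cases d)
    case (Suc e)
    have "0 \<le> coeff (pderiv p) e"
      using assms(2) by (simp add: nonneg_coeffs_def)
    then show ?thesis
      by (simp add: Suc coeff_pderiv zero_le_mult_iff)
  qed (use assms(1) in simp)
qed

lemma poly_eq_on_nats: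
  fixes p q :: "real poly"
  assumes "\<And>n::nat. poly p (real n) = poly q (real n)"
  shows "p = q"
proof (rule ccontr)
  assume "p \<noteq> q"
  then have "finite {x. poly (p - q) x = 0}"
    by (intro poly_roots_finite) simp
  moreover have "range real \<subseteq> {x. poly (p - q) x = 0}"
    using assms by auto
  ultimately have "finite (range real)"
    by (rule rev_finite_subset)
  then show False
    using finite_imageD[of real UNIV] by (simp add: inj_on_def)
qed

section \<open>Rising factorials and generalized binomial coefficients\<close>

text \<open>The binomial coefficient binomial(c + r - 1, r), or the complete homogeneous symmetric
  polynomial of degree \<open>r\<close> at \<open>c\<close> ones, extended to real
  \<open>c\<close>.\<close>

definition multichoose :: "real \<Rightarrow> int \<Rightarrow> real" where
  "multichoose c r = (if r < 0 then 0 else pochhammer c (nat r) / fact (nat r))"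

lemma multichoose_neg [simp]: "r < 0 \<Longrightarrow> multichoose c r = 0"
  by (simp add: multichoose_def)

text \<open>Pascal's rule; the value 0 at negative \<open>r\<close> makes it hold for every integer
  \<open>r\<close>.\<close>

lemma multichoose_diff: "multichoose c r - multichoose c (r - 1) = multichoose (c - 1) r"
proof (cases "r \<le> 0")
  case True
  then show ?thesis by (cases "r = 0") (auto simp: multichoose_def)
next
  case False
  define s where "s = nat (r - 1)"
  have r: "nat r = Suc s" "nat (r - 1) = s" "\<not> r < 0" "\<not> r - 1 < 0"
    using False by (auto simp: s_def)
  have "pochhammer (c - 1) (Suc s) = (c - 1) * pochhammer c s"
    using pochhammer_rec[of "c - 1" s] by simp
  then have "pochhammer c (Suc s) / fact (Suc s) - pochhammer c s / fact s =
      pochhammer (c - 1) (Suc s) / fact (Suc s)"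
    by (simp add: pochhammer_Suc divide_simps) (simp add: algebra_simps)
  then show ?thesis
    using r by (simp add: multichoose_def)
qed

definition multichoose_poly :: "real \<Rightarrow> int \<Rightarrow> real poly" where
  "multichoose_poly q r = (if r < 0 then 0 else smult (1 / fact (nat r)) (pochhammer [:q, 1:] (nat r)))"

lemma poly_pochhammer: "poly (pochhammer p n) x = pochhammer (poly p x) n"
  for x :: "'a::comm_ring_1"
  by (induction n) (simp_all add: pochhammer_Suc)

lemma poly_multichoose_poly: "poly (multichoose_poly q r) t = multichoose (t + q) r"
  by (simp add: multichoose_poly_def multichoose_def poly_pochhammer add.commute)

lemma nonneg_coeffs_pochhammer: "nonneg_coeffs (pochhammer [:0, 1:] n)"
proof (induction n)
  case (Suc n)
  have "[:0, 1:] + of_nat n = [:real n, 1:]"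
    by (simp add: of_nat_poly)
  with Suc show ?case
    unfolding pochhammer_Suc by (auto intro!: nonneg_coeffs_mult nonneg_coeffs_pCons simp del: mult_pCons_right)
qed simp

lemma multichoose_poly_0_coeffs: "nonneg_coeffs (multichoose_poly 0 r)"
  by (simp add: multichoose_poly_def nonneg_coeffs_smult nonneg_coeffs_pochhammer)

lemma multichoose_of_neg: "r > int q \<Longrightarrow> multichoose (- real q) r = 0"
  by (auto simp: multichoose_def pochhammer_of_nat_eq_0_lemma)

lemma multichoose_1: "r \<ge> 0 \<Longrightarrow> multichoose 1 r = 1"
  by (simp add: multichoose_def flip: pochhammer_fact)

text \<open>For \<open>r > q\<close> the rising factorial started at t - q runs through the factor
  t. The \<open>q\<close> factors before it contribute (-1)^q q! at t = 0, and the factors after it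
  are positive there.\<close>

lemma multichoose_poly_linear_coeff:
  assumes "r > int q"
  shows "(- 1) ^ q * coeff (multichoose_poly (- real q) r) 1 \<ge> 0"
proof -
  have q: "q \<le> nat r" "\<not> r < 0" "0 < nat r - q" using assms by auto
  have split: "pochhammer [:- real q, 1:] (nat r) =
      pochhammer [:- real q, 1:] q * pochhammer [:0, 1:] (nat r - q)"
    using pochhammer_product[OF q(1), of "[:- real q, 1:]"] by (simp add: of_nat_poly)
  have c0: "coeff (pochhammer [:0, 1:] (nat r - q)) 0 = (0::real)"
    using q(3) by (simp add: poly_pochhammer pochhammer_0_left flip: poly_0_coeff_0)
  have cq: "coeff (pochhammer [:- real q, 1:] q) 0 = (- 1) ^ q * fact q"
    by (simp add: poly_pochhammer pochhammer_same flip: poly_0_coeff_0)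
  have "coeff (multichoose_poly (- real q) r) 1 =
      (- 1) ^ q * fact q * coeff (pochhammer [:0, 1:] (nat r - q)) 1 / fact (nat r)"
    using q(2) by (simp add: multichoose_poly_def split coeff_mult_1 c0 cq del: One_nat_def)
  moreover have "coeff (pochhammer [:0, 1:] (nat r - q)) 1 \<ge> (0::real)"
    using nonneg_coeffs_pochhammer by (auto simp: nonneg_coeffs_def)
  ultimately show ?thesis
    by (simp flip: power_add mult.assoc add: power_mult_distrib[symmetric])
qed

section \<open>The determinant of Kreweras\<close>

lemma det_mat_row_add:
  fixes f g h :: "nat \<times> nat \<Rightarrow> 'a::comm_ring_1"
  assumes k: "k < n"
    and row: "\<And>j. j < n \<Longrightarrow> f (k, j) = g (k, j) + h (k, j)"
    and rest: "\<And>i j. i \<noteq> k \<Longrightarrow> f (i, j) = g (i, j)" "\<And>i j. i \<noteq> k \<Longrightarrow> f (i, j) = h (i, j)"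
  shows "det (mat n n f) = det (mat n n g) + det (mat n n h)"
proof -
  have del: "mat_delete (mat n n f') k j = mat_delete (mat n n f) k j"
    if "\<And>i j. i \<noteq> k \<Longrightarrow> f (i, j) = f' (i, j)" for f' j
    unfolding mat_delete_def using that by (intro cong_mat) auto
  have "det (mat n n f') = (\<Sum>j<n. f' (k, j) * cofactor (mat n n f) k j)"
    if "\<And>i j. i \<noteq> k \<Longrightarrow> f (i, j) = f' (i, j)" for f'
    using k by (subst laplace_expansion_row[of _ n k]) (auto simp: cofactor_def del[OF that])
  from this[of f] this[OF rest(1)] this[OF rest(2)] show ?thesis
    by (simp add: row distrib_right sum.distrib)
qed

text \<open>A window is given by its start and its length, so that cutting a shape between two rows
  only changes the window and keeps the sequences.\<close>

definition strict_dec :: "nat \<Rightarrow> nat \<Rightarrow> (nat \<Rightarrow> nat) \<Rightarrow> bool" where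
  "strict_dec u a C \<longleftrightarrow> (\<forall>i. u \<le> i \<longrightarrow> Suc i < u + a \<longrightarrow> C (Suc i) < C i)"

lemma strict_decD: "strict_dec u a C \<Longrightarrow> j < a \<Longrightarrow> i \<le> j \<Longrightarrow> C (u + j) + (j - i) \<le> C (u + i)"
proof (induction "j - i" arbitrary: j)
  case (Suc d)
  then obtain j' where j: "j = Suc j'" by (cases j) auto
  with Suc(2) have "i \<le> j'" "d = j' - i" by auto
  then have "C (u + j') + (j' - i) \<le> C (u + i)"
    using Suc j by auto
  moreover have "C (Suc (u + j')) < C (u + j')"
    using Suc j by (auto simp: strict_dec_def)
  ultimately show ?case using j by auto
qed simp

text \<open>
  With \<open>A (u + i) = \<lambda>\<^sub>i - i\<close> and \<open>B (u + j) = \<mu>\<^sub>j - j\<close> on the rows \<open>u, \<dots>, u + a - 1\<close>, this is the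
  determinant of Kreweras for the skew shape \<open>\<lambda>/\<mu>\<close>, except that the number \<open>\<tau> i\<close> of time steps may
  depend on the row.
\<close>

definition kreweras :: "nat \<Rightarrow> nat \<Rightarrow> (nat \<Rightarrow> nat) \<Rightarrow> (nat \<Rightarrow> nat) \<Rightarrow> (nat \<Rightarrow> real) \<Rightarrow> real" where
  "kreweras u a A B \<tau> = det (mat a a (\<lambda>(i, j).
     multichoose (\<tau> i + real i - real j) (int (A (u + i)) - int (B (u + j)))))"

text \<open>Only the first \<open>k\<close> rows of the window may move, while strictness is
  required in the whole window. For \<open>k = a\<close> this is the full set of sequences below
  \<open>A\<close>; smaller \<open>k\<close> are the intermediate stages of one time step. Pinning
  the other values to \<open>A\<close> gives each sequence one representative.\<close>

definition dec_below :: "nat \<Rightarrow> nat \<Rightarrow> nat \<Rightarrow> (nat \<Rightarrow> nat) \<Rightarrow> (nat \<Rightarrow> nat) set" where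
  "dec_below u a k A =
     {C. C \<le> A \<and> (\<forall>i. \<not> (u \<le> i \<and> i < u + k) \<longrightarrow> C i = A i) \<and> strict_dec u a C}"

lemma finite_dec_below: "finite (dec_below u a k A)"
proof (rule finite_subset)
  let ?I = "{u..<u + k}"
  show "dec_below u a k A \<subseteq> (\<lambda>D i. if i \<in> ?I then D i else A i) ` (PiE ?I (\<lambda>i. {..A i}))"
  proof
    fix C assume "C \<in> dec_below u a k A"
    then have "C = (\<lambda>i. if i \<in> ?I then restrict C ?I i else A i)" "restrict C ?I \<in> PiE ?I (\<lambda>i. {..A i})"
      by (auto simp: dec_below_def le_fun_def)
    then show "C \<in> (\<lambda>D i. if i \<in> ?I then D i else A i) ` (PiE ?I (\<lambda>i. {..A i}))"
      by blast
  qed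
qed (auto intro!: finite_imageI finite_PiE)

text \<open>
  Rows are advanced by one time unit one after another, from the top. Lowering \<open>A\<close> by one in the
  row being advanced telescopes, and when this makes two neighbouring entries of \<open>A\<close> collide, the
  two rows of the matrix coincide because the lower row is still one time unit behind.
\<close>

lemma kreweras_partial_sum:
  assumes "strict_dec u a A" and "k \<le> a"
  shows "kreweras u a A B (\<lambda>i. if i < k then t + 1 else t) =
    (\<Sum>C\<in>dec_below u a k A. kreweras u a C B (\<lambda>_. t))"
  using assms
proof (induction k arbitrary: A)
  case 0
  then have "dec_below u a 0 A = {A}"
    by (auto simp: dec_below_def)
  then show ?case by simp
next
  case (Suc k)
  from Suc.prems show ?case
  proof (induction "A (u + k)" arbitrary: A rule: less_induct)
    case (less A)
    let ?\<tau> = "\<lambda>k i. if i < k then t + 1 else t"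
    let ?A' = "A(u + k := A (u + k) - 1)"
    \<comment> \<open>The subtraction is done in the integers: with \<open>?A'\<close>, where it is
      cut off at 0, the decomposition of row \<open>k\<close> could fail.\<close>
    define W' where "W' = det (mat a a (\<lambda>(i, j). multichoose (?\<tau> (Suc k) i + real i - real j)
      (int (A (u + i)) - (if i = k then 1 else 0) - int (B (u + j)))))"
    have "kreweras u a A B (?\<tau> (Suc k)) = kreweras u a A B (?\<tau> k) + W'"
      unfolding kreweras_def W'_def
    proof (rule det_mat_row_add[of k])
      fix j assume "j < a"
      show "(case (k, j) of (i, j) \<Rightarrow> multichoose (?\<tau> (Suc k) i + real i - real j) (int (A (u + i)) - int (B (u + j)))) =
        (case (k, j) of (i, j) \<Rightarrow> multichoose (?\<tau> k i + real i - real j) (int (A (u + i)) - int (B (u + j)))) +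
        (case (k, j) of (i, j) \<Rightarrow> multichoose (?\<tau> (Suc k) i + real i - real j)
          (int (A (u + i)) - (if i = k then 1 else 0) - int (B (u + j))))"
        using multichoose_diff[of "t + 1 + real k - real j" "int (A (u + k)) - int (B (u + j))"]
        by (simp add: algebra_simps)
    qed (use less.prems in auto)
    moreover have "kreweras u a A B (?\<tau> k) = (\<Sum>C\<in>dec_below u a k A. kreweras u a C B (\<lambda>_. t))"
      using Suc.IH less.prems by simp
    moreover have "(\<Sum>C\<in>dec_below u a (Suc k) A. kreweras u a C B (\<lambda>_. t)) =
        (\<Sum>C\<in>dec_below u a k A. kreweras u a C B (\<lambda>_. t)) + W'"
    proof (cases "A (u + k) \<noteq> 0 \<and> strict_dec u a ?A'")
      case True
      then have pos: "A (u + k) > 0" by simp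
      have W': "W' = kreweras u a ?A' B (?\<tau> (Suc k))"
        unfolding W'_def kreweras_def using pos
        by (intro arg_cong[where f = det] cong_mat) (auto simp: of_nat_diff)
      \<comment> \<open>Row \<open>k\<close> either keeps its value or drops by at least
        one.\<close>
      have un: "dec_below u a (Suc k) A = dec_below u a k A \<union> dec_below u a (Suc k) ?A'"
      proof (intro equalityI subsetI)
        fix C assume C: "C \<in> dec_below u a (Suc k) A"
        show "C \<in> dec_below u a k A \<union> dec_below u a (Suc k) ?A'"
        proof (cases "C (u + k) = A (u + k)")
          case True
          then have "C \<in> dec_below u a k A"
            using C unfolding dec_below_def by (auto simp: less_Suc_eq)
          then show ?thesis ..
        next
          case False
          moreover have "C (u + k) \<le> A (u + k)"
            using C by (auto simp: dec_below_def le_fun_def)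
          ultimately have "C (u + k) \<le> A (u + k) - 1"
            by linarith
          then have "C \<in> dec_below u a (Suc k) ?A'"
            using C by (auto simp: dec_below_def le_fun_def)
          then show ?thesis ..
        qed
      next
        fix C assume "C \<in> dec_below u a k A \<union> dec_below u a (Suc k) ?A'"
        then show "C \<in> dec_below u a (Suc k) A"
        proof
          assume C: "C \<in> dec_below u a (Suc k) ?A'"
          have "?A' \<le> A" by (auto simp: le_fun_def)
          with C have "C \<le> A" by (auto simp: dec_below_def)
          with C show ?thesis by (auto simp: dec_below_def)
        qed (auto simp: dec_below_def)
      qed
      have "C (u + k) < A (u + k)" if "C \<le> ?A'" for C
        using le_funD[OF that, of "u + k"] pos by auto
      then have disj: "dec_below u a k A \<inter> dec_below u a (Suc k) ?A' = {}"
        by (fastforce simp: dec_below_def)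
      have "W' = (\<Sum>C\<in>dec_below u a (Suc k) ?A'. kreweras u a C B (\<lambda>_. t))"
        unfolding W' by (rule less.hyps) (use True less.prems in auto)
      then show ?thesis
        unfolding un by (subst sum.union_disjoint[OF finite_dec_below finite_dec_below disj]) simp
    next
      case False
      \<comment> \<open>Here row \<open>k\<close> is stuck: it is at 0, or the next row, which has
        not moved, occupies the value directly below.\<close>
      have eqA: "C (u + k) = A (u + k)" if C: "C \<in> dec_below u a (Suc k) A" for C
      proof (rule ccontr)
        assume neq: "C (u + k) \<noteq> A (u + k)"
        have le: "C (u + k) \<le> A (u + k)"
          using C by (auto simp: dec_below_def le_fun_def)
        then have "A (u + k) \<noteq> 0" using neq by auto
        with False have "\<not> strict_dec u a ?A'" by auto
        then obtain i where i: "u \<le> i" "Suc i < u + a" "\<not> ?A' (Suc i) < ?A' i"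
          by (auto simp: strict_dec_def)
        then have "A (Suc i) < A i" using less.prems by (auto simp: strict_dec_def)
        with i(3) have "i = u + k" "A (Suc i) = A (u + k) - 1"
          by (auto split: if_splits)
        moreover have "C (Suc i) = A (Suc i)"
          using C \<open>i = u + k\<close> by (simp add: dec_below_def)
        moreover have "C (Suc i) < C i"
          using C i(1,2) by (simp add: dec_below_def strict_dec_def)
        ultimately show False using le neq by auto
      qed
      have "dec_below u a (Suc k) A = dec_below u a k A"
      proof (intro equalityI subsetI)
        fix C assume C: "C \<in> dec_below u a (Suc k) A"
        from C eqA[OF C] show "C \<in> dec_below u a k A"
          unfolding dec_below_def by (auto simp: less_Suc_eq)
      qed (auto simp: dec_below_def)
      moreover have "W' = 0"
      \<comment> \<open>At value 0 every index in row \<open>k\<close> of the matrix is negative, so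
        the row vanishes.\<close>
      proof (cases "A (u + k) = 0")
        case True
        let ?m = "mat a a (\<lambda>(i, j). multichoose (?\<tau> (Suc k) i + real i - real j)
          (int (A (u + i)) - (if i = k then 1 else 0) - int (B (u + j))))"
        have "det ?m = (\<Sum>j<a. ?m $$ (k, j) * cofactor ?m k j)"
          using less.prems by (intro laplace_expansion_row) auto
        also have "\<dots> = 0"
          using less.prems True by (intro sum.neutral) auto
        finally show ?thesis by (simp add: W'_def)
      next
        case nz: False
        with False have "\<not> strict_dec u a ?A'" by auto
        then obtain i where i: "u \<le> i" "Suc i < u + a" "\<not> ?A' (Suc i) < ?A' i"
          by (auto simp: strict_dec_def)
        then have "A (Suc i) < A i" using less.prems by (auto simp: strict_dec_def)
        with i(3) have ik: "i = u + k" "A (Suc i) = A (u + k) - 1"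
          by (auto split: if_splits)
        then have eq: "int (A (Suc (u + k))) = int (A (u + k)) - 1"
          using nz by auto
        have k: "Suc k < a" using i ik by auto
        show ?thesis
          unfolding W'_def
          by (rule det_identical_rows[of _ a k "Suc k"])
            (use k in \<open>auto intro!: eq_vecI simp: eq add.assoc\<close>)
      qed
      ultimately show ?thesis by simp
    qed
    ultimately show ?case by simp
  qed
qed

lemma kreweras_step:
  assumes "strict_dec u a A"
  shows "kreweras u a A B (\<lambda>_. t + 1) = (\<Sum>C\<in>dec_below u a a A. kreweras u a C B (\<lambda>_. t))"
proof -
  have "kreweras u a A B (\<lambda>_. t + 1) = kreweras u a A B (\<lambda>i. if i < a then t + 1 else t)"
    unfolding kreweras_def by (intro arg_cong[where f = det] cong_mat) auto
  then show ?thesis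
    using kreweras_partial_sum[OF assms order_refl] by simp
qed

section \<open>Constant and linear coefficients of the determinant\<close>

definition kreweras_poly :: "nat \<Rightarrow> nat \<Rightarrow> (nat \<Rightarrow> nat) \<Rightarrow> (nat \<Rightarrow> nat) \<Rightarrow> real poly" where
  "kreweras_poly u a A B = det (mat a a (\<lambda>(i, j).
     multichoose_poly (real i - real j) (int (A (u + i)) - int (B (u + j)))))"

lemma poly_det: "poly (det M) t = det (map_mat (\<lambda>p. poly p t) M)"
  for t :: "'a::comm_ring_1"
proof -
  interpret comm_ring_hom "\<lambda>p. poly p t" by unfold_locales auto
  show ?thesis by simp
qed

lemma poly_kreweras_poly: "poly (kreweras_poly u a A B) t = kreweras u a A B (\<lambda>_. t)"
  unfolding kreweras_poly_def kreweras_def poly_det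
  by (intro arg_cong[where f = det] eq_matI) (auto simp: poly_multichoose_poly algebra_simps)

text \<open>
  For a connected skew shape with \<open>a \<ge> 2\<close> rows, the constant term of the matrix is strictly lower
  triangular with ones on the subdiagonal. Hence only the top right entry contributes to the linear
  coefficient of the determinant.
\<close>

lemma kreweras_poly_connected:
  assumes A: "strict_dec u a A" and B: "strict_dec u a B" and a: "a \<ge> 2"
    and conn: "\<And>i. Suc i < a \<Longrightarrow> B (u + i) \<le> A (u + Suc i)"
  shows "coeff (kreweras_poly u a A B) 0 = 0" and "0 \<le> coeff (kreweras_poly u a A B) 1"
proof -
  define r where "r i j = int (A (u + i)) - int (B (u + j))" for i j
  define M where "M = mat a a (\<lambda>(i, j). multichoose_poly (real i - real j) (r i j))"
  have M: "kreweras_poly u a A B = det M" "M \<in> carrier_mat a a"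
    by (simp_all add: kreweras_poly_def M_def r_def)
  \<comment> \<open>No row of a connected shape is empty; for the last row this follows from the
    overlap with the previous one. The bound is what makes a rising factorial started at t - (j - i)
    reach the factor t.\<close>
  have r_upper: "r i j > int (j - i)" if "i \<le> j" "j < a" for i j
  proof -
    have "B (u + i) < A (u + i)"
    proof (cases "Suc i < a")
      case True
      then have "A (u + Suc i) < A (u + i)"
        using A by (simp add: strict_dec_def)
      then show ?thesis
        using conn[OF True] by simp
    next
      case False
      then have "i = Suc (i - 1)" "Suc (i - 1) < a"
        using \<open>i \<le> j\<close> \<open>j < a\<close> a by auto
      then obtain i' where "i = Suc i'" "Suc i' < a"
        by metis
      moreover from this have "B (u + Suc i') < B (u + i')"
        using B by (simp add: strict_dec_def)
      ultimately show ?thesis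
        using conn[of i'] by simp
    qed
    then show ?thesis
      using strict_decD[OF B that(2,1)] by (simp add: r_def)
  qed
  have upper: "coeff (multichoose_poly (real i - real j) (r i j)) 0 = 0" if "i \<le> j" "j < a" for i j
    using multichoose_of_neg[OF r_upper[OF that]] that
    by (simp add: poly_multichoose_poly of_nat_diff flip: poly_0_coeff_0)
  have sub: "coeff (multichoose_poly (real (Suc i) - real i) (r (Suc i) i)) 0 = 1" if "Suc i < a" for i
    using conn[OF that] by (simp add: poly_multichoose_poly multichoose_1 r_def flip: poly_0_coeff_0)
  have row0: "det M = (\<Sum>j<a. M $$ (0, j) * cofactor M 0 j)"
    using M(2) a by (intro laplace_expansion_row) auto
  have M0: "coeff (M $$ (0, j)) 0 = 0" if "j < a" for j
    using that a upper[of 0 j] by (simp add: M_def)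
  show "coeff (kreweras_poly u a A B) 0 = 0"
    using M0 by (simp add: M(1) row0 coeff_sum coeff_mult)
  have deleted: "coeff (cofactor M 0 j) 0 = (- 1) ^ j * det (map_mat (\<lambda>p. poly p 0) (mat_delete M 0 j))" for j
    by (simp add: cofactor_def poly_det flip: poly_0_coeff_0)
  have cof_0: "coeff (cofactor M 0 j) 0 = 0" if "j < a - 1" for j
  proof -
    define N where "N = map_mat (\<lambda>p. poly p 0) (mat_delete M 0 j)"
    have N: "N \<in> carrier_mat (a - 1) (a - 1)"
      by (intro carrier_matI) (simp_all add: N_def M_def)
    \<comment> \<open>Deleting column \<open>j < a - 1\<close> keeps the last column of
      \<open>M\<close>, now at index \<open>a - 2\<close>. In the remaining rows it lies on or above
      the diagonal of \<open>M\<close>, so its constant terms vanish.\<close>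
    have zero: "N $$ (i, a - 2) = 0" if "i < a - 1" for i
    proof -
      obtain b where b: "a = Suc (Suc b)"
        using a by (metis Suc_le_D numeral_2_eq_2 Suc_le_mono)
      show ?thesis
        using that \<open>j < a - 1\<close> upper[of "Suc i" "Suc b"]
        by (simp add: b N_def M_def mat_delete_def poly_0_coeff_0 del: of_nat_Suc)
    qed
    have "det N = (\<Sum>i<a - 1. N $$ (i, a - 2) * cofactor N i (a - 2))"
      using N a by (intro laplace_expansion_column) auto
    then have "det N = 0"
      using zero by simp
    then show ?thesis
      by (simp add: deleted N_def)
  qed
  \<comment> \<open>Without row 0 and the last column the subdiagonal becomes the diagonal, and the
    matrix of constant terms is lower unitriangular.\<close>
  have cof_last: "coeff (cofactor M 0 (a - 1)) 0 = (- 1) ^ (a - 1)"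
  proof -
    define N where "N = map_mat (\<lambda>p. poly p 0) (mat_delete M 0 (a - 1))"
    have N: "N \<in> carrier_mat (a - 1) (a - 1)"
      by (intro carrier_matI) (simp_all add: N_def M_def)
    have "coeff (multichoose_poly (1 + real i - real j) (r (Suc i) j)) 0 = 0" if "i < j" "j < a" for i j
      using upper[of "Suc i" j] that by simp
    then have "det N = prod_list (diag_mat N)"
      by (intro det_lower_triangular[OF _ N])
        (auto simp: N_def M_def mat_delete_def poly_0_coeff_0)
    also have "diag_mat N = map (\<lambda>_. 1) [0..<a - 1]"
      using N sub unfolding diag_mat_def
      by (intro map_cong) (auto simp: N_def M_def mat_delete_def poly_0_coeff_0)
    also have "prod_list (map (\<lambda>_. 1) xs) = (1::real)" for xs :: "nat list"
      by (induction xs) auto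
    finally show ?thesis
      by (simp add: deleted N_def)
  qed
  have cof_0': "coeff (cofactor M 0 j) 0 = 0" if "j \<in> {..<a} - {a - 1}" for j
    using that by (intro cof_0) auto
  have "coeff (det M) 1 = (\<Sum>j<a. coeff (M $$ (0, j)) 1 * coeff (cofactor M 0 j) 0)"
    using M0 by (simp add: row0 coeff_sum coeff_mult_1 del: One_nat_def)
  also have "\<dots> = coeff (M $$ (0, a - 1)) 1 * coeff (cofactor M 0 (a - 1)) 0"
    using cof_0' a by (subst sum.remove[of _ "a - 1"]) simp_all
  also have "\<dots> = (- 1) ^ (a - 1) * coeff (multichoose_poly (- real (a - 1)) (r 0 (a - 1))) 1"
    unfolding cof_last using a by (simp add: M_def)
  also have "\<dots> \<ge> 0"
    using r_upper[of 0 "a - 1"] a by (intro multichoose_poly_linear_coeff) auto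
  finally show "0 \<le> coeff (kreweras_poly u a A B) 1"
    by (simp add: M(1))
qed

text \<open>In terms of shapes, the last assumption says that rows \<open>b - 1\<close> and
  \<open>b\<close> share no column. All indices in the lower left block are then negative, so the
  matrix is block triangular. Its lower right block has the same form because the shift depends only
  on i - j.\<close>

lemma kreweras_poly_split:
  assumes A: "strict_dec u a A" and B: "strict_dec u a B"
    and b: "b \<le> a" "b > 0" "A (u + b) < B (u + (b - 1))"
  shows "kreweras_poly u a A B = kreweras_poly u b A B * kreweras_poly (u + b) (a - b) A B"
proof -
  let ?f = "\<lambda>u (i, j). multichoose_poly (real i - real j) (int (A (u + i)) - int (B (u + j)))"
  let ?X = "mat b (a - b) (\<lambda>(i, j). ?f u (i, b + j))"
  have "mat a a (?f u) = four_block_mat (mat b b (?f u)) ?X (0\<^sub>m (a - b) b) (mat (a - b) (a - b) (?f (u + b)))"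
  proof (intro eq_matI)
    fix i j
    assume "i < dim_row (four_block_mat (mat b b (?f u)) ?X (0\<^sub>m (a - b) b) (mat (a - b) (a - b) (?f (u + b))))"
      and "j < dim_col (four_block_mat (mat b b (?f u)) ?X (0\<^sub>m (a - b) b) (mat (a - b) (a - b) (?f (u + b))))"
    then have ij: "i < a" "j < a" using b by auto
    have "A (u + i) < B (u + j)" if "b \<le> i" "j < b"
    proof -
      have "b - 1 < a" "j \<le> b - 1"
        using b that by auto
      then have "A (u + i) \<le> A (u + b)" "B (u + (b - 1)) \<le> B (u + j)"
        using strict_decD[OF A, of i b] strict_decD[OF B, of "b - 1" j] ij that by auto
      with b show ?thesis by simp
    qed
    then show "mat a a (?f u) $$ (i, j) =
        four_block_mat (mat b b (?f u)) ?X (0\<^sub>m (a - b) b) (mat (a - b) (a - b) (?f (u + b))) $$ (i, j)"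
      using ij b by (auto simp: of_nat_diff multichoose_poly_def)
  qed (use b in auto)
  moreover have "det (four_block_mat (mat b b (?f u)) ?X (0\<^sub>m (a - b) b) (mat (a - b) (a - b) (?f (u + b)))) =
      det (mat b b (?f u)) * det (mat (a - b) (a - b) (?f (u + b)))"
    by (rule det_four_block_mat_lower_left_zero) auto
  ultimately show ?thesis
    unfolding kreweras_poly_def by simp
qed

text \<open>A shape that is not connected is cut in two. Constant terms being 0 or 1, the product
  rule keeps the linear coefficient nonnegative. The constant terms form the identity of the
  incidence algebra, the linear ones its logarithm L of the zeta function.\<close>

lemma kreweras_poly_low_coeffs:
  assumes "strict_dec u a A" and "strict_dec u a B"
  shows "coeff (kreweras_poly u a A B) 0 = (if \<forall>i. u \<le> i \<and> i < u + a \<longrightarrow> A i = B i then 1 else 0)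
    \<and> 0 \<le> coeff (kreweras_poly u a A B) 1"
  using assms
proof (induction a arbitrary: u rule: less_induct)
  case (less a)
  consider "a = 0" | "a = 1" | "a \<ge> 2" "\<And>i. Suc i < a \<Longrightarrow> B (u + i) \<le> A (u + Suc i)"
    | i where "Suc i < a" "A (u + Suc i) < B (u + i)"
    by (cases "a = 0 \<or> a = 1") (auto simp: not_le, force)
  then show ?case
  proof cases
    case 1
    then show ?thesis by (simp add: kreweras_poly_def)
  next
    case 2
    let ?r = "int (A u) - int (B u)"
    have D: "kreweras_poly u a A B = multichoose_poly 0 ?r"
      by (simp add: 2 kreweras_poly_def det_single)
    have "coeff (multichoose_poly 0 ?r) 0 = (if A u = B u then 1 else 0)"
      by (auto simp: poly_multichoose_poly multichoose_def pochhammer_0_left simp flip: poly_0_coeff_0)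
    then show ?thesis
      using multichoose_poly_0_coeffs[of ?r] unfolding D nonneg_coeffs_def
      by (auto simp: 2 le_less_Suc_eq)
  next
    case 3
    have "A u \<noteq> B u"
      using less.prems(1) 3(1) 3(2)[of 0] by (fastforce simp: strict_dec_def)
    then have "\<not> (\<forall>i. u \<le> i \<and> i < u + a \<longrightarrow> A i = B i)"
      using 3(1) by auto
    then show ?thesis
      using kreweras_poly_connected[OF less.prems 3] by (auto simp del: One_nat_def)
  next
    case (4 i)
    let ?b = "Suc i"
    have D: "kreweras_poly u a A B = kreweras_poly u ?b A B * kreweras_poly (u + ?b) (a - ?b) A B"
      using less.prems 4 by (intro kreweras_poly_split) auto
    have s: "strict_dec u ?b C" "strict_dec (u + ?b) (a - ?b) C" if "strict_dec u a C" for C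
      using that 4 by (auto simp: strict_dec_def)
    have ih1: "coeff (kreweras_poly u ?b A B) 0 = (if \<forall>i. u \<le> i \<and> i < u + ?b \<longrightarrow> A i = B i then 1 else 0)"
        "0 \<le> coeff (kreweras_poly u ?b A B) 1"
      using less.IH[of ?b u] s less.prems 4 by blast+
    have ih2: "coeff (kreweras_poly (u + ?b) (a - ?b) A B) 0 =
          (if \<forall>i. u + ?b \<le> i \<and> i < u + ?b + (a - ?b) \<longrightarrow> A i = B i then 1 else 0)"
        "0 \<le> coeff (kreweras_poly (u + ?b) (a - ?b) A B) 1"
      using less.IH[of "a - ?b" "u + ?b"] s less.prems 4 by auto
    have "u \<le> x \<and> x < u + a \<longleftrightarrow> u \<le> x \<and> x < u + ?b \<or> u + ?b \<le> x \<and> x < u + ?b + (a - ?b)" for x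
      using 4 by auto
    then have iff: "(\<forall>i. u \<le> i \<and> i < u + a \<longrightarrow> A i = B i) \<longleftrightarrow>
        (\<forall>i. u \<le> i \<and> i < u + ?b \<longrightarrow> A i = B i) \<and>
        (\<forall>i. u + ?b \<le> i \<and> i < u + ?b + (a - ?b) \<longrightarrow> A i = B i)"
      by blast
    have "0 \<le> coeff (kreweras_poly u a A B) 1"
      unfolding D coeff_mult_1 using ih1 ih2 by (auto simp del: One_nat_def)
    moreover have "coeff (kreweras_poly u a A B) 0 =
        coeff (kreweras_poly u ?b A B) 0 * coeff (kreweras_poly (u + ?b) (a - ?b) A B) 0"
      by (simp add: D coeff_mult)
    ultimately show ?thesis
      unfolding ih1(1) ih2(1) iff by simp
  qed
qed

section \<open>The incidence algebra of strictly decreasing sequences\<close>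

lemma dec_belowD:
  assumes "C \<in> dec_below u a k A"
  shows "C \<le> A" "C i \<le> A i" "\<not> (u \<le> i \<and> i < u + k) \<Longrightarrow> C i = A i" "strict_dec u a C"
  using assms by (auto simp: dec_below_def le_fun_def)

lemma dec_below_self: "strict_dec u a A \<Longrightarrow> A \<in> dec_below u a k A"
  by (simp add: dec_below_def)

lemma dec_below_trans: "C \<in> dec_below u a k A \<Longrightarrow> dec_below u a k C \<subseteq> dec_below u a k A"
  by (auto simp: dec_below_def)

lemma kreweras_0:
  assumes "strict_dec u a A" and "strict_dec u a B"
  shows "kreweras u a A B (\<lambda>_. 0) = (if \<forall>i. u \<le> i \<and> i < u + a \<longrightarrow> A i = B i then 1 else 0)"
  using kreweras_poly_low_coeffs[OF assms] by (simp add: poly_kreweras_poly flip: poly_0_coeff_0)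

lemma kreweras_Suc:
  assumes "strict_dec u a A"
  shows "kreweras u a A B (\<lambda>_. real (Suc n)) = (\<Sum>C\<in>dec_below u a a A. kreweras u a C B (\<lambda>_. real n))"
  using kreweras_step[OF assms, of B "real n"] by (simp add: add.commute)

text \<open>Steps only descend, so they never reach a \<open>B\<close> that is not below
  \<open>A\<close>. Vanishing at all natural times passes to the polynomial, hence to all real
  times.\<close>

lemma kreweras_poly_eq_0:
  assumes "strict_dec u a A" and B: "strict_dec u a B" and "\<not> (\<forall>i. u \<le> i \<and> i < u + a \<longrightarrow> B i \<le> A i)"
  shows "kreweras_poly u a A B = 0"
proof (rule poly_eq_on_nats)
  fix n
  have "kreweras u a A B (\<lambda>_. real n) = 0"
    using assms(1,3)
  proof (induction n arbitrary: A)
    case 0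
    then have "\<not> (\<forall>i. u \<le> i \<and> i < u + a \<longrightarrow> A i = B i)"
      by (metis order_refl)
    then show ?case
      using kreweras_0[OF 0(1) B] by simp
  next
    case (Suc n)
    have "kreweras u a C B (\<lambda>_. real n) = 0" if "C \<in> dec_below u a a A" for C
      using Suc.prems dec_belowD[OF that] by (intro Suc.IH) (auto intro: order_trans)
    then show ?case
      unfolding kreweras_Suc[OF Suc.prems(1)] by simp
  qed
  then show "poly (kreweras_poly u a A B) (real n) = poly 0 (real n)"
    by (simp add: poly_kreweras_poly)
qed

lemma kreweras_eq_0:
  assumes "strict_dec u a A" and "strict_dec u a B" and "\<not> (\<forall>i. u \<le> i \<and> i < u + a \<longrightarrow> B i \<le> A i)"
  shows "kreweras u a A B (\<lambda>_. t) = 0"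
  using kreweras_poly_eq_0[OF assms] by (simp flip: poly_kreweras_poly)

lemma kreweras_poly_refl:
  assumes A: "strict_dec u a A"
  shows "kreweras_poly u a A A = 1"
proof (rule poly_eq_on_nats)
  fix n
  have "kreweras u a A A (\<lambda>_. real n) = 1"
  proof (induction n)
    case 0
    then show ?case using kreweras_0[OF A A] by simp
  next
    case (Suc n)
    have zero: "kreweras u a C A (\<lambda>_. real n) = 0" if "C \<in> dec_below u a a A - {A}" for C
    proof (rule kreweras_eq_0[OF _ A])
      show "\<not> (\<forall>i. u \<le> i \<and> i < u + a \<longrightarrow> A i \<le> C i)"
      proof
        assume "\<forall>i. u \<le> i \<and> i < u + a \<longrightarrow> A i \<le> C i"
        then have "C = A"
          using that dec_belowD(2,3)[of C u a a A] by (intro ext) (metis DiffD1 order_antisym)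
        with that show False by simp
      qed
    qed (use that in \<open>auto dest: dec_belowD\<close>)
    then show ?case
      unfolding kreweras_Suc[OF A]
      by (subst sum.remove[OF finite_dec_below dec_below_self[OF A]]) (simp add: Suc sum.neutral)
  qed
  then show "poly (kreweras_poly u a A A) (real n) = poly 1 (real n)"
    by (simp add: poly_kreweras_poly)
qed

text \<open>The rule zeta^(s + n) = zeta^s zeta^n. The induction peels single steps off
  \<open>n\<close> by \<open>kreweras_step\<close>, which holds at real times; thus \<open>s\<close>
  stays an arbitrary real and the identity can be differentiated in it.\<close>

lemma kreweras_convolution:
  assumes "strict_dec u a A" and B: "strict_dec u a B"
  shows "kreweras u a A B (\<lambda>_. s + real n) =
    (\<Sum>C\<in>dec_below u a a A. kreweras u a C B (\<lambda>_. s) * kreweras u a A C (\<lambda>_. real n))"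
  using assms(1)
proof (induction n arbitrary: A)
  case 0
  have "kreweras u a A C (\<lambda>_. 0) = 0" if "C \<in> dec_below u a a A - {A}" for C
  proof -
    have "\<not> (\<forall>i. u \<le> i \<and> i < u + a \<longrightarrow> A i = C i)"
    proof
      assume "\<forall>i. u \<le> i \<and> i < u + a \<longrightarrow> A i = C i"
      then have "C = A"
        using that dec_belowD(3)[of C u a a A] by (intro ext) (metis DiffD1)
      with that show False by simp
    qed
    moreover have "strict_dec u a C"
      using that dec_belowD(4) by auto
    ultimately show ?thesis
      using kreweras_0[OF 0, of C] by simp
  qed
  then show ?case
    by (subst sum.remove[OF finite_dec_below dec_below_self[OF 0]]) (simp add: kreweras_0[OF 0 0])
next
  case (Suc n)
  let ?S = "dec_below u a a A"
  \<comment> \<open>Summing over the fixed set \<open>?S\<close> instead of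
    \<open>dec_below u a a D\<close> allows the two sums to be interchanged; the added terms have
    \<open>C\<close> not below \<open>D\<close> and vanish.\<close>
  have inner: "kreweras u a D B (\<lambda>_. s + real n) =
      (\<Sum>C\<in>?S. kreweras u a C B (\<lambda>_. s) * kreweras u a D C (\<lambda>_. real n))" if D: "D \<in> ?S" for D
  proof -
    have "kreweras u a D C (\<lambda>_. real n) = 0" if C: "C \<in> ?S - dec_below u a a D" for C
    proof (rule kreweras_eq_0)
      show "\<not> (\<forall>i. u \<le> i \<and> i < u + a \<longrightarrow> C i \<le> D i)"
      proof
        assume le: "\<forall>i. u \<le> i \<and> i < u + a \<longrightarrow> C i \<le> D i"
        have eq: "C i = D i" if "\<not> (u \<le> i \<and> i < u + a)" for i
          using C D dec_belowD(3)[of C u a a A i] dec_belowD(3)[of D u a a A i] that by auto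
        have "C i \<le> D i" for i
          by (cases "u \<le> i \<and> i < u + a") (use le eq in auto)
        then have "C \<le> D"
          by (simp add: le_fun_def)
        with eq C show False
          by (auto simp: dec_below_def)
      qed
    qed (use C D in \<open>auto dest: dec_belowD\<close>)
    then show ?thesis
      unfolding Suc.IH[OF dec_belowD(4)[OF D]]
      by (intro sum.mono_neutral_left finite_dec_below dec_below_trans[OF D]) auto
  qed
  have "kreweras u a A B (\<lambda>_. s + real (Suc n)) = (\<Sum>D\<in>?S. kreweras u a D B (\<lambda>_. s + real n))"
    using kreweras_step[OF Suc.prems, of B "s + real n"] by (simp add: algebra_simps)
  also have "\<dots> = (\<Sum>D\<in>?S. \<Sum>C\<in>?S. kreweras u a C B (\<lambda>_. s) * kreweras u a D C (\<lambda>_. real n))"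
    by (simp add: inner)
  also have "\<dots> = (\<Sum>C\<in>?S. kreweras u a C B (\<lambda>_. s) * (\<Sum>D\<in>?S. kreweras u a D C (\<lambda>_. real n)))"
    by (subst sum.swap) (simp add: sum_distrib_left)
  finally show ?case
    by (simp only: kreweras_Suc[OF Suc.prems])
qed

text \<open>The convolution identity, differentiated at \<open>s = 0\<close>.\<close>

lemma pderiv_kreweras_poly:
  assumes A: "strict_dec u a A" and B: "strict_dec u a B"
  shows "pderiv (kreweras_poly u a A B) =
    (\<Sum>C\<in>dec_below u a a A. smult (coeff (kreweras_poly u a C B) 1) (kreweras_poly u a A C))"
proof (rule poly_eq_on_nats)
  fix n
  have shift: "pcompose (kreweras_poly u a A B) [:real n, 1:] =
      (\<Sum>C\<in>dec_below u a a A. smult (kreweras u a A C (\<lambda>_. real n)) (kreweras_poly u a C B))"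
  proof (rule poly_eq_on_nats)
    fix l
    show "poly (pcompose (kreweras_poly u a A B) [:real n, 1:]) (real l) =
        poly (\<Sum>C\<in>dec_below u a a A. smult (kreweras u a A C (\<lambda>_. real n)) (kreweras_poly u a C B)) (real l)"
      using kreweras_convolution[OF A B, of "real l" n]
      by (simp add: poly_pcompose poly_kreweras_poly poly_sum add.commute[of "real n"] mult.commute)
  qed
  \<comment> \<open>The linear coefficient of f(s + n) as a polynomial in s is f'(n).\<close>
  have "poly (pderiv (kreweras_poly u a A B)) (real n) = coeff (pcompose (kreweras_poly u a A B) [:real n, 1:]) 1"
    using coeff_pderiv[of "pcompose (kreweras_poly u a A B) [:real n, 1:]" 0]
    by (simp add: pderiv_pcompose poly_pcompose pderiv_pCons flip: poly_0_coeff_0)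
  also have "\<dots> = (\<Sum>C\<in>dec_below u a a A. kreweras u a A C (\<lambda>_. real n) * coeff (kreweras_poly u a C B) 1)"
    by (simp add: shift coeff_sum)
  finally show "poly (pderiv (kreweras_poly u a A B)) (real n) = poly (\<Sum>C\<in>dec_below u a a A.
      smult (coeff (kreweras_poly u a C B) 1) (kreweras_poly u a A C)) (real n)"
    by (simp add: poly_sum poly_kreweras_poly mult.commute)
qed

text \<open>Induction on the size of the skew shape. In the sum for the derivative, a
  \<open>C\<close> not above \<open>B\<close> contributes 0, and so does one equal to
  \<open>B\<close> on the window, where the polynomial is the constant 1. Every other
  \<open>C\<close> leaves a smaller shape between \<open>C\<close> and \<open>A\<close>.\<close>

theorem nonneg_coeffs_kreweras_poly:
  assumes A: "strict_dec u a A" and B: "strict_dec u a B"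
  shows "nonneg_coeffs (kreweras_poly u a A B)"
  using B
proof (induction "sum A {u..<u + a} - sum B {u..<u + a}" arbitrary: B rule: less_induct)
  case (less B)
  have "nonneg_coeffs (smult (coeff (kreweras_poly u a C B) 1) (kreweras_poly u a A C))"
    if C: "C \<in> dec_below u a a A" for C
  proof -
    note C' = dec_belowD[OF C]
    show ?thesis
    proof (cases "\<forall>i. u \<le> i \<and> i < u + a \<longrightarrow> B i \<le> C i")
      case False
      then show ?thesis
        by (simp only: kreweras_poly_eq_0[OF C'(4) less.prems False] coeff_0 smult_0_left nonneg_coeffs_0)
    next
      case le: True
      show ?thesis
      proof (cases "\<forall>i. u \<le> i \<and> i < u + a \<longrightarrow> B i = C i")
        case True
        then have "kreweras_poly u a C B = kreweras_poly u a C C"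
          unfolding kreweras_poly_def by (intro arg_cong[where f = det] cong_mat) auto
        also have "\<dots> = 1"
          by (rule kreweras_poly_refl[OF C'(4)])
        finally show ?thesis
          by simp
      next
        case False
        then obtain i where "u \<le> i" "i < u + a" "B i \<noteq> C i"
          by blast
        moreover from this have "B i < C i"
          using le by (simp add: le_neq_implies_less)
        ultimately have "sum B {u..<u + a} < sum C {u..<u + a}"
          using le by (intro sum_strict_mono_ex1) (simp, simp, rule bexI[of _ i], simp_all)
        moreover have "sum C {u..<u + a} \<le> sum A {u..<u + a}"
          by (intro sum_mono C'(2))
        \<comment> \<open>The truncated difference really drops, since the sum of \<open>B\<close>
          is less than that of \<open>C\<close>, which is at most that of \<open>A\<close>.\<close>
        ultimately have "nonneg_coeffs (kreweras_poly u a A C)"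
          by (intro less.hyps C'(4)) linarith
        then show ?thesis
          by (intro nonneg_coeffs_smult conjunct2[OF kreweras_poly_low_coeffs[OF C'(4) less.prems]])
      qed
    qed
  qed
  then have "nonneg_coeffs (pderiv (kreweras_poly u a A B))"
    unfolding pderiv_kreweras_poly[OF A less.prems] by (intro nonneg_coeffs_sum)
  then show ?case
    using kreweras_poly_low_coeffs[OF A less.prems] by (intro nonneg_coeffs_pderivI[of "kreweras_poly u a A B"]) simp_all
qed

section \<open>Multichains counted by the determinant\<close>

primrec multichains :: "'a::order set \<Rightarrow> nat \<Rightarrow> 'a \<Rightarrow> 'a \<Rightarrow> nat" where
  "multichains S 0 s t = (if s = t then 1 else 0)"
| "multichains S (Suc n) s t = (\<Sum>r | r \<in> S \<and> r \<le> t. multichains S n s r)"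

text \<open>\<open>S\<close> is convex among the strict sequences that agree with it outside the
  window. By convexity a sequence below \<open>t\<close> that is not in \<open>S\<close> is not
  above \<open>s\<close>, and the determinant vanishes there; so the recursion for the determinant
  restricts to \<open>S\<close>.\<close>

lemma kreweras_eq_multichains:
  assumes strict: "\<And>v. v \<in> S \<Longrightarrow> strict_dec u a v"
    and outside: "\<And>v w i. v \<in> S \<Longrightarrow> w \<in> S \<Longrightarrow> \<not> (u \<le> i \<and> i < u + a) \<Longrightarrow> v i = w i"
    and interval: "\<And>v w C. v \<in> S \<Longrightarrow> w \<in> S \<Longrightarrow> v \<le> C \<Longrightarrow> C \<in> dec_below u a a w \<Longrightarrow> C \<in> S"
    and s: "s \<in> S" and "t \<in> S"
  shows "kreweras u a t s (\<lambda>_. real n) = real (multichains S n s t)"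
  using \<open>t \<in> S\<close>
proof (induction n arbitrary: t)
  case 0
  have "(\<forall>i. u \<le> i \<and> i < u + a \<longrightarrow> t i = s i) \<longleftrightarrow> t = s"
    using outside[OF 0 s] by (auto simp: fun_eq_iff)
  then show ?case
    using kreweras_0[OF strict[OF 0] strict[OF s]] by auto
next
  case (Suc n)
  let ?D = "dec_below u a a t"
  have sub: "{r. r \<in> S \<and> r \<le> t} \<subseteq> ?D"
    using strict outside Suc.prems by (auto simp: dec_below_def)
  have "kreweras u a C s (\<lambda>_. real n) = 0" if C: "C \<in> ?D - {r. r \<in> S \<and> r \<le> t}" for C
  proof (rule kreweras_eq_0)
    show "\<not> (\<forall>i. u \<le> i \<and> i < u + a \<longrightarrow> s i \<le> C i)"
    proof
      assume le: "\<forall>i. u \<le> i \<and> i < u + a \<longrightarrow> s i \<le> C i"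
      have "C i = s i" if "\<not> (u \<le> i \<and> i < u + a)" for i
        using C dec_belowD(3)[of C u a a t i] outside[OF s Suc.prems, of i] that by auto
      then have "s i \<le> C i" for i
        by (cases "u \<le> i \<and> i < u + a") (use le in auto)
      then have "s \<le> C"
        by (simp add: le_fun_def)
      with C show False
        using interval[OF s Suc.prems, of C] by (auto simp: dec_belowD)
    qed
  qed (use C s strict in \<open>auto dest: dec_belowD\<close>)
  then have "(\<Sum>C\<in>?D. kreweras u a C s (\<lambda>_. real n)) = (\<Sum>C | C \<in> S \<and> C \<le> t. kreweras u a C s (\<lambda>_. real n))"
    using sub by (intro sum.mono_neutral_right finite_dec_below) auto
  also have "\<dots> = (\<Sum>C | C \<in> S \<and> C \<le> t. real (multichains S n s C))"
    using Suc.IH by (intro sum.cong) auto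
  finally show ?case
    by (simp only: kreweras_Suc[OF strict[OF Suc.prems]] multichains.simps of_nat_sum)
qed

section \<open>Walks through a sequence of posets\<close>

lemma multichains_nonzeroD: "multichains S n s t \<noteq> 0 \<Longrightarrow> s \<le> t"
proof (induction n arbitrary: t)
  case (Suc n)
  then have "(\<Sum>r | r \<in> S \<and> r \<le> t. multichains S n s r) \<noteq> 0"
    by simp
  then obtain r where "r \<le> t" "multichains S n s r \<noteq> 0"
    by (rule sum.not_neutral_contains_not_neutral) auto
  with Suc.IH show ?case
    by (blast intro: order_trans)
qed (simp split: if_splits)

locale block_walk =
  fixes V :: "'a::order set" and A :: "nat \<Rightarrow> 'a set" and z :: 'a
  assumes finite_V: "finite V"
    and A_sub: "A g \<subseteq> V"
    and z_in: "z \<in> V"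
    and least: "s \<in> V \<Longrightarrow> t \<in> A g \<Longrightarrow> s \<le> t \<Longrightarrow> \<exists>r\<in>A g. s \<le> r \<and> (\<forall>t\<in>A g. s \<le> t \<longrightarrow> r \<le> t)"
    and multichains_poly: "s \<in> A g \<Longrightarrow> t \<in> A g \<Longrightarrow>
      \<exists>q. nonneg_coeffs q \<and> (\<forall>n. poly q (real n) = real (multichains (A g) n s t))"
begin

text \<open>Step \<open>p + 1\<close> lands in block \<open>p div n\<close>, so each block receives
  exactly \<open>n\<close> states, counting the one by which it is entered. The start precedes block
  0 and may lie outside \<open>A 0\<close>.\<close>

primrec walks :: "nat \<Rightarrow> nat \<Rightarrow> 'a \<Rightarrow> nat" where
  "walks n 0 t = (if t = z then 1 else 0)"
| "walks n (Suc p) t = (if t \<in> A (p div n) then \<Sum>s | s \<in> V \<and> s \<le> t. walks n p s else 0)"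

definition enterable :: "nat \<Rightarrow> 'a set" where
  "enterable g = {s \<in> V. \<exists>t\<in>A g. s \<le> t}"

definition entry :: "nat \<Rightarrow> 'a \<Rightarrow> 'a" where
  "entry g s = (SOME r. r \<in> A g \<and> s \<le> r \<and> (\<forall>t\<in>A g. s \<le> t \<longrightarrow> r \<le> t))"

lemma entry:
  assumes "s \<in> enterable g"
  shows "entry g s \<in> A g" and "t \<in> A g \<Longrightarrow> entry g s \<le> t \<longleftrightarrow> s \<le> t"
proof -
  have "\<exists>r. r \<in> A g \<and> s \<le> r \<and> (\<forall>t\<in>A g. s \<le> t \<longrightarrow> r \<le> t)"
    using assms least unfolding enterable_def by blast
  then have *: "entry g s \<in> A g \<and> s \<le> entry g s \<and> (\<forall>t\<in>A g. s \<le> t \<longrightarrow> entry g s \<le> t)"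
    unfolding entry_def by (rule someI_ex)
  then show "entry g s \<in> A g"
    by blast
  show "entry g s \<le> t \<longleftrightarrow> s \<le> t" if "t \<in> A g"
    using * that order_trans[of s "entry g s" t] by blast
qed

lemma finite_enterable: "finite (enterable g)"
  using finite_V by (simp add: enterable_def)

lemma finite_A: "finite (A g)"
  using finite_V A_sub by (rule rev_finite_subset)

text \<open>
  A walk can enter \<open>A g\<close> from \<open>s\<close> only above the least such element. Counting the walks inside
  \<open>A g\<close> from that element makes the number of steps exactly the length of the block, without a
  shift by one that would destroy the positivity of coefficients.
\<close>

lemma walks_block:
  assumes "q < n"
  shows "walks n (n * g + Suc q) t =
    (if t \<in> A g then \<Sum>s\<in>enterable g. walks n (n * g) s * multichains (A g) (Suc q) (entry g s) t else 0)"
  using assms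
proof (induction q arbitrary: t)
  case 0
  show ?case
  proof (cases "t \<in> A g")
    case True
    have "multichains (A g) (Suc 0) (entry g s) t = (if s \<le> t then 1 else 0)" if "s \<in> enterable g" for s
      using entry[OF that] True finite_A[of g] by simp
    then have "(\<Sum>s\<in>enterable g. walks n (n * g) s * multichains (A g) (Suc 0) (entry g s) t) =
        (\<Sum>s\<in>enterable g. if s \<le> t then walks n (n * g) s else 0)"
      by (intro sum.cong) simp_all
    also have "\<dots> = (\<Sum>s\<in>enterable g \<inter> {s. s \<le> t}. walks n (n * g) s)"
      by (simp add: sum.If_cases finite_enterable)
    also have "enterable g \<inter> {s. s \<le> t} = {s. s \<in> V \<and> s \<le> t}"
      using True by (auto simp: enterable_def)
    finally show ?thesis
      using True 0 by simp
  qed (use 0 in simp)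
next
  case (Suc q)
  have IH: "walks n (n * g + Suc q) r =
      (if r \<in> A g then \<Sum>s\<in>enterable g. walks n (n * g) s * multichains (A g) (Suc q) (entry g s) r else 0)" for r
    using Suc.prems by (intro Suc.IH) simp
  have div: "(n * g + Suc q) div n = g"
    using Suc.prems by (intro div_nat_eqI) auto
  show ?case
  proof (cases "t \<in> A g")
    case True
    have "walks n (n * g + Suc (Suc q)) t = (\<Sum>r | r \<in> V \<and> r \<le> t. walks n (n * g + Suc q) r)"
      using True div by simp
    also have "\<dots> = (\<Sum>r | r \<in> A g \<and> r \<le> t. walks n (n * g + Suc q) r)"
      using A_sub[of g] finite_V IH by (intro sum.mono_neutral_right) auto
    also have "\<dots> = (\<Sum>r | r \<in> A g \<and> r \<le> t. \<Sum>s\<in>enterable g.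
        walks n (n * g) s * multichains (A g) (Suc q) (entry g s) r)"
      by (rule sum.cong[OF refl]) (simp only: IH mem_Collect_eq if_True)
    also have "\<dots> = (\<Sum>s\<in>enterable g. walks n (n * g) s *
        (\<Sum>r | r \<in> A g \<and> r \<le> t. multichains (A g) (Suc q) (entry g s) r))"
      by (subst sum.swap) (simp only: sum_distrib_left)
    finally show ?thesis
      using True by simp
  qed (use div in simp)
qed

definition chain_poly :: "nat \<Rightarrow> 'a \<Rightarrow> 'a \<Rightarrow> real poly" where
  "chain_poly g s t = (SOME q. nonneg_coeffs q \<and> (\<forall>n. poly q (real n) = real (multichains (A g) n s t)))"

lemma chain_poly:
  assumes "s \<in> A g" and "t \<in> A g"
  shows "nonneg_coeffs (chain_poly g s t)"
    and "poly (chain_poly g s t) (real n) = real (multichains (A g) n s t)"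
proof -
  have "nonneg_coeffs (chain_poly g s t) \<and> (\<forall>n. poly (chain_poly g s t) (real n) = real (multichains (A g) n s t))"
    unfolding chain_poly_def using multichains_poly[OF assms] by (rule someI_ex)
  then show "nonneg_coeffs (chain_poly g s t)"
    and "poly (chain_poly g s t) (real n) = real (multichains (A g) n s t)"
    by auto
qed

lemma chain_poly_nonzeroD:
  assumes "s \<in> A g" and "t \<in> A g" and "chain_poly g s t \<noteq> 0"
  shows "s \<le> t"
proof (rule ccontr)
  assume "\<not> s \<le> t"
  then have "multichains (A g) n s t = 0" for n
    using multichains_nonzeroD by blast
  then have "chain_poly g s t = 0"
    by (intro poly_eq_on_nats) (simp add: chain_poly(2)[OF assms(1,2)])
  with assms(3) show False by simp
qed

primrec walk_poly :: "nat \<Rightarrow> 'a \<Rightarrow> real poly" where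
  "walk_poly 0 t = (if t = z then 1 else 0)"
| "walk_poly (Suc g) t =
    (if t \<in> A g then \<Sum>s\<in>enterable g. walk_poly g s * chain_poly g (entry g s) t else 0)"

lemma nonneg_coeffs_walk_poly: "nonneg_coeffs (walk_poly g t)"
proof (induction g arbitrary: t)
  case (Suc g)
  then show ?case
    using entry(1) by (auto intro!: nonneg_coeffs_sum nonneg_coeffs_mult chain_poly(1))
qed simp

lemma poly_walk_poly:
  assumes "n > 0"
  shows "poly (walk_poly g t) (real n) = real (walks n (n * g) t)"
proof (induction g arbitrary: t)
  case (Suc g)
  obtain q where q: "n = Suc q"
    using assms by (cases n) auto
  have "walks n (n * Suc g) t = walks n (n * g + Suc q) t"
    by (simp add: q algebra_simps)
  also have "real \<dots> = poly (walk_poly (Suc g) t) (real n)"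
    unfolding walks_block[of q n g t, unfolded q, OF lessI] q
    using Suc entry(1) by (auto simp: poly_sum chain_poly(2) q simp del: of_nat_Suc multichains.simps intro!: sum.cong)
  finally show ?case ..
qed simp

lemma walk_poly_at_0:
  "(\<forall>t. walk_poly g t = 0) \<or>
   (\<exists>r\<in>V. \<forall>t. poly (walk_poly g t) 0 = (if t = r then 1 else 0) \<and> (walk_poly g t \<noteq> 0 \<longrightarrow> r \<le> t))"
proof (induction g)
  case 0
  then show ?case
    using z_in by auto
next
  case (Suc g)
  from Suc.IH show ?case
  proof
    assume "\<forall>t. walk_poly g t = 0"
    then show ?thesis by simp
  next
    assume "\<exists>r\<in>V. \<forall>t. poly (walk_poly g t) 0 = (if t = r then 1 else 0) \<and> (walk_poly g t \<noteq> 0 \<longrightarrow> r \<le> t)"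
    then obtain r where r: "r \<in> V" "\<And>t. poly (walk_poly g t) 0 = (if t = r then 1 else 0)"
        "\<And>t. walk_poly g t \<noteq> 0 \<Longrightarrow> r \<le> t"
      by blast
    show ?thesis
    proof (cases "r \<in> enterable g")
      case False
      have "walk_poly g s = 0" if "s \<in> enterable g" for s
        using that False r(1) r(3)[of s] by (auto simp: enterable_def dest: order_trans)
      then have "\<forall>t. walk_poly (Suc g) t = 0"
        by simp
      then show ?thesis ..
    next
      case True
      note er = entry[OF True]
      have at0: "poly (chain_poly g s t) 0 = (if s = t then 1 else 0)" if "s \<in> A g" "t \<in> A g" for s t
        using chain_poly(2)[OF that, of 0] by simp
      have "poly (walk_poly (Suc g) t) 0 = (if t = entry g r then 1 else 0)" for t
      proof (cases "t \<in> A g")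
        case t: True
        have "poly (walk_poly (Suc g) t) 0 = (\<Sum>s\<in>enterable g. if s = r then poly (chain_poly g (entry g s) t) 0 else 0)"
          using t by (simp add: poly_sum r(2) if_distrib[of "\<lambda>x. x * _"] cong: if_cong)
        also have "\<dots> = poly (chain_poly g (entry g r) t) 0"
          using True finite_enterable by simp
        finally show ?thesis
          using at0[OF er(1) t] by auto
      qed (use er(1) in auto)
      moreover have "entry g r \<le> t" if nz: "walk_poly (Suc g) t \<noteq> 0" for t
      proof -
        have t: "t \<in> A g"
          using nz by (simp split: if_splits)
        then have "(\<Sum>s\<in>enterable g. walk_poly g s * chain_poly g (entry g s) t) \<noteq> 0"
          using nz by simp
        then obtain s where s: "s \<in> enterable g" "walk_poly g s \<noteq> 0" "chain_poly g (entry g s) t \<noteq> 0"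
          by (rule sum.not_neutral_contains_not_neutral) auto
        have "r \<le> s" "s \<le> t"
          using r(3) s entry[OF s(1)] chain_poly_nonzeroD[OF _ t s(3)] t by auto
        then show ?thesis
          using er(2)[OF t] by (blast intro: order_trans)
      qed
      ultimately show ?thesis
        using er(1) A_sub by blast
    qed
  qed
qed

text \<open>The constant term is 0 or 1, and it is 0 only if the whole polynomial vanishes. With
  nonnegative coefficients this is visible at 1, so existence of a walk with blocks of length 1
  decides it.\<close>

theorem walks_polynomial:
  "\<exists>E. nonneg_coeffs E \<and> (\<forall>n>0. poly E (real n) = real (\<Sum>t\<in>V. walks n (n * g) t)) \<and>
     poly E 0 = (if (\<Sum>t\<in>V. walks 1 g t) = 0 then 0 else 1)"
proof (intro exI conjI allI impI)
  let ?E = "\<Sum>t\<in>V. walk_poly g t"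
  show nonneg: "nonneg_coeffs ?E"
    by (intro nonneg_coeffs_sum nonneg_coeffs_walk_poly)
  show at: "poly ?E (real n) = real (\<Sum>t\<in>V. walks n (n * g) t)" if "n > 0" for n
    using that by (simp add: poly_sum poly_walk_poly)
  have E1: "poly ?E 1 = real (\<Sum>t\<in>V. walks 1 g t)"
    using at[of 1] by simp
  show "poly ?E 0 = (if (\<Sum>t\<in>V. walks 1 g t) = 0 then 0 else 1)"
    using walk_poly_at_0[of g]
  proof
    assume "\<forall>t. walk_poly g t = 0"
    then have "?E = 0"
      by simp
    then show ?thesis
      using E1 by (metis of_nat_eq_0_iff poly_0)
  next
    assume "\<exists>r\<in>V. \<forall>t. poly (walk_poly g t) 0 = (if t = r then 1 else 0) \<and> (walk_poly g t \<noteq> 0 \<longrightarrow> r \<le> t)"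
    then obtain r where "r \<in> V" "\<And>t. poly (walk_poly g t) 0 = (if t = r then 1 else 0)"
      by blast
    then have E0: "poly ?E 0 = 1"
      using finite_V by (simp add: poly_sum)
    then have "?E \<noteq> 0"
      by auto
    then have "real (\<Sum>t\<in>V. walks 1 g t) \<noteq> 0"
      using nonneg_coeffs_eq_0_iff[OF nonneg] E1 by metis
    then have "(\<Sum>t\<in>V. walks 1 g t) \<noteq> 0"
      by (metis of_nat_0)
    then show ?thesis
      using E0 by (simp only: if_False)
  qed
qed

section \<open>Walks as explicit sequences of states\<close>

definition walk_set :: "nat \<Rightarrow> nat \<Rightarrow> (nat \<Rightarrow> 'a) set" where
  "walk_set n p = {v \<in> {..p} \<rightarrow>\<^sub>E V. v 0 = z \<and> (\<forall>q<p. v q \<le> v (Suc q) \<and> v (Suc q) \<in> A (q div n))}"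

lemma finite_walk_set: "finite (walk_set n p)"
proof (rule finite_subset)
  show "walk_set n p \<subseteq> {..p} \<rightarrow>\<^sub>E V"
    by (auto simp: walk_set_def)
qed (use finite_V in \<open>simp add: finite_PiE\<close>)

lemma card_walk_set_end: "t \<in> V \<Longrightarrow> card {v \<in> walk_set n p. v p = t} = walks n p t"
proof (induction p arbitrary: t)
  case 0
  have "{v \<in> walk_set n 0. v 0 = t} = (if t = z then {restrict (\<lambda>_. z) {..0}} else {})"
    using z_in by (auto simp: walk_set_def PiE_iff extensional_def fun_eq_iff)
  then show ?case by simp
next
  case (Suc p)
  show ?case
  proof (cases "t \<in> A (p div n)")
    case False
    then have "{v \<in> walk_set n (Suc p). v (Suc p) = t} = {}"
      by (auto simp: walk_set_def)
    with False show ?thesis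
      by (simp only: card.empty walks.simps if_False)
  next
    case True
    let ?W = "{v \<in> walk_set n p. v p \<le> t}" and ?ext = "\<lambda>v. v(Suc p := t)"
    have "{v \<in> walk_set n (Suc p). v (Suc p) = t} = ?ext ` ?W"
    proof (intro equalityI subsetI)
      fix v assume v: "v \<in> {v \<in> walk_set n (Suc p). v (Suc p) = t}"
      then have "restrict v {..p} \<in> ?W"
        by (auto simp: walk_set_def)
      moreover have "v = ?ext (restrict v {..p})"
        using v by (auto simp: walk_set_def fun_eq_iff PiE_iff extensional_def le_Suc_eq)
      ultimately show "v \<in> ?ext ` ?W"
        by blast
    next
      fix v assume "v \<in> ?ext ` ?W"
      then show "v \<in> {v \<in> walk_set n (Suc p). v (Suc p) = t}"
        using True Suc.prems by (auto simp: walk_set_def PiE_iff extensional_def less_Suc_eq)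
    qed
    moreover have "inj_on ?ext ?W"
    proof (rule inj_onI)
      fix v w assume vw: "v \<in> ?W" "w \<in> ?W" "?ext v = ?ext w"
      show "v = w"
      proof
        fix q
        show "v q = w q"
        proof (cases "q = Suc p")
          case True
          then show ?thesis
            using vw(1,2) by (auto simp: walk_set_def PiE_iff extensional_def)
        next
          case False
          then show ?thesis
            using fun_cong[OF vw(3), of q] by simp
        qed
      qed
    qed
    ultimately have "card {v \<in> walk_set n (Suc p). v (Suc p) = t} = card ?W"
      by (simp add: card_image)
    also have "?W = (\<Union>s\<in>{s. s \<in> V \<and> s \<le> t}. {v \<in> walk_set n p. v p = s})"
      by (auto simp: walk_set_def)
    also have "card \<dots> = (\<Sum>s | s \<in> V \<and> s \<le> t. card {v \<in> walk_set n p. v p = s})"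
      using finite_V finite_walk_set by (intro card_UN_disjoint) auto
    also have "\<dots> = walks n (Suc p) t"
      using True Suc.IH by simp
    finally show ?thesis .
  qed
qed

lemma card_walk_set: "card (walk_set n p) = (\<Sum>t\<in>V. walks n p t)"
proof -
  have "walk_set n p = (\<Union>t\<in>V. {v \<in> walk_set n p. v p = t})"
    by (auto simp: walk_set_def)
  also have "card \<dots> = (\<Sum>t\<in>V. card {v \<in> walk_set n p. v p = t})"
    using finite_V finite_walk_set by (intro card_UN_disjoint) auto
  finally show ?thesis
    by (simp add: card_walk_set_end)
qed

end

section \<open>Level sets of Gelfand--Tsetlin patterns\<close>

lemma card_down_closed:
  fixes S :: "nat set"
  assumes "finite S" and "\<And>j l. l \<in> S \<Longrightarrow> j \<le> l \<Longrightarrow> j \<in> S"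
  shows "j \<in> S \<longleftrightarrow> j < card S"
proof -
  obtain n where "S = {..<n}"
  proof (cases "S = {}")
    case False
    then have "Max S \<in> S"
      using assms(1) by simp
    then have "{..<Suc (Max S)} \<subseteq> S"
      using assms(2)[OF \<open>Max S \<in> S\<close>] by (simp add: less_Suc_eq_le subset_iff)
    moreover have "S \<subseteq> {..<Suc (Max S)}"
      using assms(1) by (simp add: less_Suc_eq_le subset_iff)
    ultimately show ?thesis
      using that by blast
  qed (use that[of 0] in simp)
  then show ?thesis by simp
qed

lemma card_down_closed_from_1:
  fixes S :: "nat set"
  assumes "S \<subseteq> {1..n}" and "\<And>j l. l \<in> S \<Longrightarrow> 1 \<le> j \<Longrightarrow> j \<le> l \<Longrightarrow> j \<in> S" and "1 \<le> j"
  shows "j \<in> S \<longleftrightarrow> j \<le> card S"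
proof -
  have fin: "finite S" "0 \<notin> S"
    using assms(1) finite_subset by auto
  have "j \<in> insert 0 S \<longleftrightarrow> j < card (insert 0 S)"
  proof (rule card_down_closed)
    show "j \<in> insert 0 S" if "l \<in> insert 0 S" "j \<le> l" for j l
      using assms(2)[of l j] that by (cases "j = 0") auto
  qed (use fin in simp)
  then show ?thesis
    using fin assms(3) by auto
qed

lemma threshold_index:
  fixes Y :: "nat \<Rightarrow> nat"
  assumes "mono Y"
  obtains u where "u \<le> k" "\<And>i. i \<in> {1..k} \<Longrightarrow> Y i \<le> g \<longleftrightarrow> i \<le> u"
proof -
  have "\<exists>u\<le>k. \<forall>i\<in>{1..k}. Y i \<le> g \<longleftrightarrow> i \<le> u"
  proof (induction k)
    case (Suc k)
    then obtain u where u: "u \<le> k" "\<forall>i\<in>{1..k}. Y i \<le> g \<longleftrightarrow> i \<le> u"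
      by blast
    show ?case
    proof (cases "Y (Suc k) \<le> g")
      case True
      then have "Y i \<le> g" if "i \<le> Suc k" for i
        using monoD[OF assms that] by simp
      then show ?thesis
        by (intro exI[of _ "Suc k"]) auto
    next
      case False
      then show ?thesis
        using u by (intro exI[of _ u]) (auto simp: le_Suc_eq)
    qed
  qed simp
  with that show ?thesis by blast
qed

text \<open>
  Cut an integer array at height \<open>p\<close>: \<open>v i\<close> counts the entries of row \<open>i\<close>, boundary columns
  included, that lie below \<open>p\<close>. The states allowed for \<open>p \<in> {n * g + 1..n * (g + 1)}\<close> do not
  depend on \<open>p\<close>.
\<close>

locale gt_shape =
  fixes k m :: nat and Y Z :: "nat \<Rightarrow> nat"
  assumes mono_Y: "mono Y" and mono_Z: "mono Z"
begin

definition states :: "(nat \<Rightarrow> nat) set" where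
  "states = {v. (\<forall>i\<in>{1..k}. v i \<le> m + 2) \<and> (\<forall>i. i \<notin> {1..k} \<longrightarrow> v i = 0)}"

text \<open>At heights \<open>p\<close> of block \<open>g\<close>, the boundary value
  \<open>n * Z i\<close> is below \<open>p\<close> iff \<open>Z i \<le> g\<close>, and likewise for
  \<open>Y\<close>. The last condition is the diagonal inequality: if entry j of row i + 1 is below
  \<open>p\<close>, so is entry j + 1 of row i.\<close>

definition allowed :: "nat \<Rightarrow> (nat \<Rightarrow> nat) set" where
  "allowed g = {v \<in> states. \<forall>i\<in>{1..k}. (v i = 0 \<longleftrightarrow> g < Z i) \<and> (v i = m + 2 \<longleftrightarrow> Y i \<le> g) \<and>
     (i < k \<longrightarrow> (\<forall>j\<le>m. j < v (Suc i) \<longrightarrow> Suc j < v i))}"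

lemma finite_states: "finite states"
proof -
  have "states = {v. \<forall>i. (i \<in> {1..k} \<longrightarrow> v i \<in> {..m + 2}) \<and> (i \<notin> {1..k} \<longrightarrow> v i = 0)}"
    by (auto simp: states_def)
  then show ?thesis
    using finite_set_of_finite_funs[of "{1..k}" "{..m + 2}" 0] by simp
qed

lemma allowed_inf:
  assumes "v \<in> allowed g" and "w \<in> allowed g"
  shows "(\<lambda>i. min (v i) (w i)) \<in> allowed g"
  using assms unfolding allowed_def states_def
  by (auto simp: min_def)

text \<open>In a family closed under pointwise minimum, an element of least sum above
  \<open>s\<close> is below all the others.\<close>

lemma allowed_least:
  assumes "t \<in> allowed g" and "s \<le> t"
  shows "\<exists>r\<in>allowed g. s \<le> r \<and> (\<forall>t\<in>allowed g. s \<le> t \<longrightarrow> r \<le> t)"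
proof -
  obtain r where r: "r \<in> allowed g" "s \<le> r"
      "\<And>w. w \<in> allowed g \<Longrightarrow> s \<le> w \<Longrightarrow> sum r {1..k} \<le> sum w {1..k}"
    using ex_has_least_nat[of "\<lambda>w. w \<in> allowed g \<and> s \<le> w" t "\<lambda>w. sum w {1..k}"] assms by blast
  have "r \<le> w" if w: "w \<in> allowed g" "s \<le> w" for w
  proof (rule le_funI, rule ccontr)
    fix i assume "\<not> r i \<le> w i"
    then have "i \<in> {1..k}" "w i < r i"
      using r(1) by (auto simp: allowed_def states_def)
    then have "(\<Sum>i\<in>{1..k}. min (r i) (w i)) < sum r {1..k}"
      by (intro sum_strict_mono_ex1) (auto intro!: bexI[of _ i])
    moreover have "s \<le> (\<lambda>i. min (r i) (w i))"
      using r(2) w(2) by (simp add: le_fun_def)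
    ultimately show False
      using r(3)[OF allowed_inf[OF r(1) w(1)]] by simp
  qed
  with r(1,2) show ?thesis by blast
qed

text \<open>Rows up to \<open>u\<close> are full and rows beyond \<open>w\<close> are empty in every
  state of the block. Only the rows between vary; there the diagonal inequality makes the states
  strictly decreasing, and the states are convex among such sequences.\<close>

lemma allowed_chains_poly:
  assumes s: "s \<in> allowed g" and t: "t \<in> allowed g"
  shows "\<exists>q. nonneg_coeffs q \<and> (\<forall>n. poly q (real n) = real (multichains (allowed g) n s t))"
proof -
  obtain u where u: "u \<le> k" "\<And>i. i \<in> {1..k} \<Longrightarrow> Y i \<le> g \<longleftrightarrow> i \<le> u"
    using threshold_index[OF mono_Y] by metis
  obtain w where w: "w \<le> k" "\<And>i. i \<in> {1..k} \<Longrightarrow> Z i \<le> g \<longleftrightarrow> i \<le> w"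
    using threshold_index[OF mono_Z] by metis
  have bottom: "v i = 0 \<longleftrightarrow> w < i" and top: "v i = m + 2 \<longleftrightarrow> i \<le> u"
    and le: "v i \<le> m + 2" if "v \<in> allowed g" "i \<in> {1..k}" for v i
    using that u(2)[of i] w(2)[of i] by (auto simp: allowed_def states_def)
  have uw: "u \<le> w"
    using bottom[OF s, of u] top[OF s, of u] u(1) by (cases "u = 0") fastforce+
  let ?a = "w - u"
  have strict: "strict_dec (Suc u) ?a v" if v: "v \<in> allowed g" for v
    unfolding strict_dec_def
  proof (intro allI impI)
    fix i assume i: "Suc u \<le> i" "Suc i < Suc u + ?a"
    then have ik: "i \<in> {1..k}" "Suc i \<in> {1..k}" "i < k"
      using uw w(1) by auto
    \<comment> \<open>The diagonal condition reaches only \<open>j \<le> m\<close>. It applies to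
      \<open>j = v (Suc i) - 1\<close> because a row inside the window is neither empty nor
      full.\<close>
    have "v (Suc i) \<noteq> 0" "v (Suc i) \<noteq> m + 2"
      using bottom[OF v ik(2)] top[OF v ik(2)] i uw by auto
    then obtain j where j: "v (Suc i) = Suc j" "j \<le> m"
      using le[OF v ik(2)] by (cases "v (Suc i)") auto
    then have "Suc j < v i"
      using v ik by (auto simp: allowed_def)
    then show "v (Suc i) < v i"
      by (simp add: j)
  qed
  have outside: "v i = v' i" if v: "v \<in> allowed g" and v': "v' \<in> allowed g" and i: "\<not> (Suc u \<le> i \<and> i < Suc u + ?a)" for v v' i
  proof (cases "i \<in> {1..k}")
    case True
    then consider "i \<le> u" | "w < i"
      using i uw by linarith
    then show ?thesis
      using bottom[OF v True] bottom[OF v' True] top[OF v True] top[OF v' True]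
      by cases auto
  next
    case False
    then show ?thesis
      using v v' by (auto simp: allowed_def states_def)
  qed
  have interval: "C \<in> allowed g"
    if v: "v \<in> allowed g" and v': "v' \<in> allowed g" and vC: "v \<le> C" and C: "C \<in> dec_below (Suc u) ?a ?a v'"
    for v v' C
  proof -
    note C' = dec_belowD[OF C]
    have range: "v i \<le> C i" "C i \<le> v' i" for i
      using vC C'(1) by (auto simp: le_fun_def)
    have "C i \<le> m + 2" if "i \<in> {1..k}" for i
      using range(2)[of i] le[OF v' that] by simp
    moreover have "C i = 0" if "i \<notin> {1..k}" for i
      using range(2)[of i] v' that by (auto simp: allowed_def states_def)
    moreover have "C i = 0 \<longleftrightarrow> g < Z i" "C i = m + 2 \<longleftrightarrow> Y i \<le> g" if "i \<in> {1..k}" for i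
      using range[of i] le[OF v that] le[OF v' that] bottom[OF v that] bottom[OF v' that]
        top[OF v that] top[OF v' that] u(2)[OF that] w(2)[OF that] by linarith+
    moreover have "Suc j < C i" if "i \<in> {1..k}" "i < k" "j \<le> m" "j < C (Suc i)" for i j
    proof -
      consider "i \<le> u" | "Suc u \<le> i" "Suc i \<le> w" | "w < Suc i"
        by linarith
      then show ?thesis
      proof cases
        case 1
        then show ?thesis
          using top[OF v that(1)] range(1)[of i] that(3) by simp
      next
        case 2
        then have "C (Suc i) < C i"
          using C'(4) uw by (auto simp: strict_dec_def)
        then show ?thesis
          using that by simp
      next
        case 3
        then show ?thesis
          using bottom[OF v', of "Suc i"] range(2)[of "Suc i"] that by simp
      qed
    qed
    ultimately show ?thesis
      unfolding allowed_def states_def by blast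
  qed
  show ?thesis
  proof (intro exI conjI allI)
    show "nonneg_coeffs (kreweras_poly (Suc u) ?a t s)"
      using strict s t by (intro nonneg_coeffs_kreweras_poly)
    show "poly (kreweras_poly (Suc u) ?a t s) (real n) = real (multichains (allowed g) n s t)" for n
      unfolding poly_kreweras_poly
      by (rule kreweras_eq_multichains[OF _ _ _ s t])
        (erule strict, erule (2) outside, erule (3) interval)
  qed
qed

text \<open>The zero state is the level set at height 0, below which no entry lies.\<close>

sublocale block_walk states allowed "\<lambda>_. 0"
proof
  show "finite states"
    by (rule finite_states)
  show "allowed g \<subseteq> states" for g
    by (auto simp: allowed_def)
  show "(\<lambda>_. 0) \<in> states"
    by (simp add: states_def)
  show "\<exists>r\<in>allowed g. s \<le> r \<and> (\<forall>t\<in>allowed g. s \<le> t \<longrightarrow> r \<le> t)"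
    if "s \<in> states" "t \<in> allowed g" "s \<le> t" for s t g
    using that(2,3) by (rule allowed_least)
  show "\<exists>q. nonneg_coeffs q \<and> (\<forall>n. poly q (real n) = real (multichains (allowed g) n s t))"
    if "s \<in> allowed g" "t \<in> allowed g" for s t g
    using that by (rule allowed_chains_poly)
qed

end

lemma div_less_iff_nat: "n > 0 \<Longrightarrow> q div n < c \<longleftrightarrow> q < n * c" for q n c :: nat
  by (simp add: div_less_iff_less_mult mult.commute)

lemma card_atLeast1_le: "c \<le> N \<Longrightarrow> card {q \<in> {1..N}. q \<le> c} = c" for c N :: nat
proof -
  assume "c \<le> N"
  then have "{q \<in> {1..N}. q \<le> c} = {1..c}" by auto
  then show ?thesis by simp
qed

section \<open>Bijection between walks and integer points of dilates\<close>

context gt_shape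
begin

definition int_entry :: "nat \<Rightarrow> (nat \<times> nat \<Rightarrow> nat) \<Rightarrow> nat \<Rightarrow> nat \<Rightarrow> nat" where
  "int_entry n X i j = (if j = 0 then n * Z i else if j = m + 1 then n * Y i else X (i, j))"

text \<open>Natural entries suffice, since each row starts at a nonnegative boundary value and
  increases weakly.\<close>

definition int_points :: "nat \<Rightarrow> (nat \<times> nat \<Rightarrow> nat) set" where
  "int_points n = {X \<in> gt_index k m \<rightarrow>\<^sub>E UNIV. \<forall>i\<in>{1..k}. \<forall>j\<le>m.
     int_entry n X i j \<le> int_entry n X i (Suc j) \<and>
     (i < k \<longrightarrow> int_entry n X i (Suc j) \<le> int_entry n X (Suc i) j)}"

text \<open>A number x at most \<open>N\<close> is the number of heights q in 1..N with q \<le> x,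
  and column j is at least q exactly when at most j entries of its row are below q.\<close>

definition of_walk :: "nat \<Rightarrow> (nat \<Rightarrow> nat \<Rightarrow> nat) \<Rightarrow> nat \<times> nat \<Rightarrow> nat" where
  "of_walk N v = (\<lambda>(i, j)\<in>gt_index k m. card {q \<in> {1..N}. v q i \<le> j})"

definition to_walk :: "nat \<Rightarrow> nat \<Rightarrow> (nat \<times> nat \<Rightarrow> nat) \<Rightarrow> nat \<Rightarrow> nat \<Rightarrow> nat" where
  "to_walk n N X = (\<lambda>q\<in>{..N}. \<lambda>i. if i \<in> {1..k} then card {j \<in> {..m + 1}. int_entry n X i j < q} else 0)"

lemma int_points_mono:
  assumes X: "X \<in> int_points n" and i: "i \<in> {1..k}" and "j \<le> l" "l \<le> m + 1"
  shows "int_entry n X i j \<le> int_entry n X i l"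
  using assms(3,4)
proof (induction l rule: dec_induct)
  case (step l)
  then have "int_entry n X i l \<le> int_entry n X i (Suc l)"
    using X i by (auto simp: int_points_def)
  with step show ?case by simp
qed simp

text \<open>Rows increase weakly, so the entries below \<open>q\<close> fill an initial segment of
  the columns and their number determines them.\<close>

lemma to_walk_less_iff:
  assumes X: "X \<in> int_points n" and i: "i \<in> {1..k}" and q: "q \<le> N" and j: "j \<le> m + 1"
  shows "j < to_walk n N X q i \<longleftrightarrow> int_entry n X i j < q"
proof -
  have "j \<in> {j \<in> {..m + 1}. int_entry n X i j < q} \<longleftrightarrow> j < card {j \<in> {..m + 1}. int_entry n X i j < q}"
  proof (rule card_down_closed)
    fix j l assume "l \<in> {j \<in> {..m + 1}. int_entry n X i j < q}" "j \<le> l"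
    then show "j \<in> {j \<in> {..m + 1}. int_entry n X i j < q}"
      using int_points_mono[OF X i, of j l] by auto
  qed simp
  then show ?thesis
    using i q j by (simp add: to_walk_def)
qed

lemma to_walk_le: "q \<le> N \<Longrightarrow> to_walk n N X q i \<le> m + 2"
proof -
  have "card {j \<in> {..m + 1}. int_entry n X i j < q} \<le> card {..m + 1}"
    by (intro card_mono) auto
  then show "q \<le> N \<Longrightarrow> to_walk n N X q i \<le> m + 2"
    by (simp add: to_walk_def)
qed

lemma to_walk_in_walk_set:
  assumes X: "X \<in> int_points n" and n: "n > 0"
  shows "to_walk n N X \<in> walk_set n N"
proof -
  let ?v = "to_walk n N X"
  have states: "?v q \<in> states" if "q \<le> N" for q
    using to_walk_le[OF that] that by (simp add: states_def) (simp add: to_walk_def)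
  moreover have "?v q \<le> ?v (Suc q)" if "q < N" for q
    using that by (auto simp: to_walk_def le_fun_def intro!: card_mono)
  \<comment> \<open>Being below \<open>Suc q\<close> means being at most \<open>q\<close>, and
    \<open>n * Z i \<le> q\<close> iff \<open>Z i \<le> q div n\<close>. This is why the block index
    is taken from \<open>q\<close> and not from \<open>Suc q\<close>.\<close>
  moreover have "?v (Suc q) \<in> allowed (q div n)" if q: "q < N" for q
  proof -
    have less: "j < ?v (Suc q) i \<longleftrightarrow> int_entry n X i j < Suc q" if "i \<in> {1..k}" "j \<le> m + 1" for i j
      using to_walk_less_iff[OF X that(1) _ that(2)] q by simp
    have "?v (Suc q) i = 0 \<longleftrightarrow> q div n < Z i" if "i \<in> {1..k}" for i
      using less[OF that, of 0] by (auto simp: int_entry_def div_less_iff_nat[OF n])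
    moreover have "?v (Suc q) i = m + 2 \<longleftrightarrow> Y i \<le> q div n" if "i \<in> {1..k}" for i
      using less[OF that, of "m + 1"] to_walk_le[of "Suc q" N n X i] q div_less_iff_nat[OF n, of q "Y i"]
      by (auto simp: int_entry_def)
    moreover have "Suc j < ?v (Suc q) i" if "i \<in> {1..k}" "i < k" "j \<le> m" "j < ?v (Suc q) (Suc i)" for i j
    proof -
      have "int_entry n X i (Suc j) \<le> int_entry n X (Suc i) j"
        using X that by (auto simp: int_points_def)
      then show ?thesis
        using less[of "Suc i" j] less[of i "Suc j"] that by auto
    qed
    ultimately show ?thesis
      using states[of "Suc q"] q unfolding allowed_def by auto
  qed
  moreover have "?v 0 = (\<lambda>_. 0)"
    by (auto simp: to_walk_def)
  moreover have "?v \<in> extensional {..N}"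
    by (simp add: to_walk_def)
  ultimately show ?thesis
    by (auto simp: walk_set_def PiE_iff)
qed

lemma walk_set_mono:
  assumes "v \<in> walk_set n N" and "q \<le> l" "l \<le> N"
  shows "v q \<le> v l"
  using assms(2,3)
proof (induction l rule: dec_induct)
  case (step l)
  then have "v l \<le> v (Suc l)"
    using assms(1) by (auto simp: walk_set_def)
  with step show ?case by auto
qed simp

lemma walk_set_allowed:
  assumes "v \<in> walk_set n N" and "q \<in> {1..N}"
  shows "v q \<in> allowed ((q - 1) div n)"
  using assms by (cases q) (auto simp: walk_set_def)

lemma le_card_walk_iff:
  assumes v: "v \<in> walk_set n N" and q: "q \<in> {1..N}"
  shows "q \<le> card {q \<in> {1..N}. v q i \<le> j} \<longleftrightarrow> v q i \<le> j"
proof -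
  have "q \<in> {q \<in> {1..N}. v q i \<le> j} \<longleftrightarrow> q \<le> card {q \<in> {1..N}. v q i \<le> j}"
  proof (rule card_down_closed_from_1[of _ N])
    fix q l assume "l \<in> {q \<in> {1..N}. v q i \<le> j}" "1 \<le> q" "q \<le> l"
    then show "q \<in> {q \<in> {1..N}. v q i \<le> j}"
      using le_funD[OF walk_set_mono[OF v, of q l], of i] by auto
  qed (use q in auto)
  then show ?thesis
    using q by simp
qed

text \<open>The blocks prescribe when a row becomes nonempty and when it becomes full, which
  reproduces the boundary columns, provided \<open>N\<close> reaches beyond all boundary
  values.\<close>

lemma int_entry_of_walk:
  assumes v: "v \<in> walk_set n N" and n: "n > 0" and i: "i \<in> {1..k}" and j: "j \<le> m + 1"
    and N: "n * Y i \<le> N" "n * Z i \<le> N"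
  shows "int_entry n (of_walk N v) i j = card {q \<in> {1..N}. v q i \<le> j}"
proof -
  have *: "(v q i = 0 \<longleftrightarrow> (q - 1) div n < Z i) \<and> (v q i = m + 2 \<longleftrightarrow> Y i \<le> (q - 1) div n) \<and> v q i \<le> m + 2"
    if "q \<in> {1..N}" for q
    using walk_set_allowed[OF v that] i by (auto simp: allowed_def states_def)
  consider "j = 0" | "j = m + 1" | "j \<in> {1..m}"
    using j by (cases "j = 0 \<or> j = m + 1") auto
  then show ?thesis
  proof cases
    case 1
    have "{q \<in> {1..N}. v q i \<le> 0} = {q \<in> {1..N}. q \<le> n * Z i}"
      using * by (auto simp: div_less_iff_nat[OF n])
    then show ?thesis
      using 1 card_atLeast1_le[OF N(2)] by (simp add: int_entry_def)
  next
    case 2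
    have "v q i \<le> m + 1 \<longleftrightarrow> q \<le> n * Y i" if q: "q \<in> {1..N}" for q
    proof -
      have "v q i \<le> m + 1 \<longleftrightarrow> v q i \<noteq> m + 2"
        using *[OF q] by linarith
      also have "\<dots> \<longleftrightarrow> (q - 1) div n < Y i"
        using *[OF q] by auto
      also have "\<dots> \<longleftrightarrow> q \<le> n * Y i"
        using q by (auto simp: div_less_iff_nat[OF n])
      finally show ?thesis .
    qed
    then have "{q \<in> {1..N}. v q i \<le> m + 1} = {q \<in> {1..N}. q \<le> n * Y i}"
      by blast
    then show ?thesis
      using 2 card_atLeast1_le[OF N(1)] by (simp add: int_entry_def)
  next
    case 3
    then show ?thesis
      using i by (auto simp: int_entry_def of_walk_def gt_index_def)
  qed
qed

text \<open>Transposition, as for conjugate partitions: the two maps count the relation between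
  heights and columns along one index or the other.\<close>

lemma bij_betw_walks_int_points:
  assumes n: "n > 0" and N: "\<And>i. i \<in> {1..k} \<Longrightarrow> n * Y i \<le> N \<and> n * Z i \<le> N"
  shows "bij_betw (of_walk N) (walk_set n N) (int_points n)"
proof (rule bij_betw_byWitness[where f' = "to_walk n N"])
  have entry: "int_entry n (of_walk N v) i j = card {q \<in> {1..N}. v q i \<le> j}"
    if "v \<in> walk_set n N" "i \<in> {1..k}" "j \<le> m + 1" for v i j
    using int_entry_of_walk[OF that(1) n that(2,3)] N[OF that(2)] by blast
  show "to_walk n N ` int_points n \<subseteq> walk_set n N"
    using to_walk_in_walk_set n by blast
  show "of_walk N ` walk_set n N \<subseteq> int_points n"
  proof
    fix X assume "X \<in> of_walk N ` walk_set n N"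
    then obtain v where v: "v \<in> walk_set n N" and X: "X = of_walk N v"
      by blast
    have "int_entry n X i j \<le> int_entry n X i (Suc j)" if "i \<in> {1..k}" "j \<le> m" for i j
      unfolding X using that by (simp add: entry[OF v] del: One_nat_def) (auto intro!: card_mono)
    moreover have "int_entry n X i (Suc j) \<le> int_entry n X (Suc i) j"
      if ij: "i \<in> {1..k}" "i < k" "j \<le> m" for i j
    proof -
      have "v q (Suc i) \<le> j" if "q \<in> {1..N}" "v q i \<le> Suc j" for q
      proof (rule ccontr)
        assume "\<not> v q (Suc i) \<le> j"
        then have "Suc j < v q i"
          using walk_set_allowed[OF v that(1)] ij by (auto simp: allowed_def)
        with that(2) show False by simp
      qed
      then have "card {q \<in> {1..N}. v q i \<le> Suc j} \<le> card {q \<in> {1..N}. v q (Suc i) \<le> j}"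
        by (intro card_mono) auto
      then show ?thesis
        unfolding X using entry[OF v, of i "Suc j"] entry[OF v, of "Suc i" j] ij by simp
    qed
    moreover have "X \<in> gt_index k m \<rightarrow>\<^sub>E UNIV"
      by (auto simp: X of_walk_def)
    ultimately show "X \<in> int_points n"
      unfolding int_points_def by blast
  qed
  show "\<forall>v\<in>walk_set n N. to_walk n N (of_walk N v) = v"
  proof (intro ballI ext)
    fix v q i assume v: "v \<in> walk_set n N"
    consider "q > N" | "q = 0" | "q \<in> {1..N}" "i \<in> {1..k}" | "q \<le> N" "i \<notin> {1..k}"
      by fastforce
    then show "to_walk n N (of_walk N v) q i = v q i"
    proof cases
      case 1
      then show ?thesis
        using v by (auto simp: to_walk_def walk_set_def PiE_iff extensional_def)
    next
      case 2
      then show ?thesis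
        using v by (auto simp: to_walk_def walk_set_def)
    next
      case 3
      have le: "v q i \<le> m + 2"
        using walk_set_allowed[OF v 3(1)] 3(2) by (auto simp: allowed_def states_def)
      have "int_entry n (of_walk N v) i j < q \<longleftrightarrow> j < v q i" if "j \<le> m + 1" for j
        using le_card_walk_iff[OF v 3(1), of i j] entry[OF v 3(2) that] by (simp add: not_le flip: not_less)
      then have "{j \<in> {..m + 1}. int_entry n (of_walk N v) i j < q} = {..<v q i}"
        using le by auto
      then show ?thesis
        using 3 by (simp add: to_walk_def)
    next
      case 4
      then have "v q \<in> states"
        using v by (auto simp: walk_set_def PiE_iff)
      then have "v q i = 0"
        using 4(2) unfolding states_def by blast
      with 4 show ?thesis
        by (auto simp: to_walk_def)
    qed
  qed
  show "\<forall>X\<in>int_points n. of_walk N (to_walk n N X) = X"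
  proof (intro ballI ext)
    fix X and p :: "nat \<times> nat" assume X: "X \<in> int_points n"
    obtain i j where p: "p = (i, j)" by force
    show "of_walk N (to_walk n N X) p = X p"
    proof (cases "p \<in> gt_index k m")
      case True
      then have i: "i \<in> {1..k}" and j: "j \<in> {1..m}"
        by (auto simp: p gt_index_def)
      have Xij: "int_entry n X i j = X p"
        using j by (simp add: int_entry_def p)
      have "to_walk n N X q i \<le> j \<longleftrightarrow> q \<le> X p" if "q \<in> {1..N}" for q
        using to_walk_less_iff[OF X i, of q N j] that j Xij by auto
      then have "{q \<in> {1..N}. to_walk n N X q i \<le> j} = {q \<in> {1..N}. q \<le> X p}"
        by blast
      moreover have "X p \<le> N"
        using int_points_mono[OF X i, of j "m + 1"] N[OF i] j Xij by (simp add: int_entry_def)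
      ultimately show ?thesis
        using True card_atLeast1_le[of "X p" N] by (simp add: of_walk_def p)
    next
      case False
      have "X \<in> gt_index k m \<rightarrow>\<^sub>E UNIV"
        using X unfolding int_points_def by blast
      then have "X p = undefined"
        using False by (rule PiE_arb)
      then show ?thesis
        using False by (simp only: of_walk_def restrict_apply if_False)
    qed
  qed
qed

lemma int_points_polynomial:
  assumes b: "\<And>i. i \<in> {1..k} \<Longrightarrow> Y i \<le> b \<and> Z i \<le> b"
  shows "\<exists>E. nonneg_coeffs E \<and> poly E 0 = (if int_points 1 = {} then 0 else 1) \<and>
    (\<forall>n>0. finite (int_points n) \<and> poly E (real n) = real (card (int_points n)))"
proof -
  have bij: "bij_betw (of_walk (n * b)) (walk_set n (n * b)) (int_points n)" if "n > 0" for n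
    using that b by (intro bij_betw_walks_int_points) auto
  have fin: "finite (int_points n)" if "n > 0" for n
    using bij_betw_finite[OF bij[OF that]] finite_walk_set by blast
  have card: "(\<Sum>t\<in>states. walks n (n * b) t) = card (int_points n)" if "n > 0" for n
    using bij_betw_same_card[OF bij[OF that]] card_walk_set[of n "n * b"] by simp
  have "(\<Sum>t\<in>states. walks 1 b t) = card (int_points 1)"
    using card[of 1] by simp
  then have empty: "(\<Sum>t\<in>states. walks 1 b t) = 0 \<longleftrightarrow> int_points 1 = {}"
    using fin[of 1] by (simp only: card_0_eq zero_less_one)
  obtain E where E: "nonneg_coeffs E"
      "poly E 0 = (if (\<Sum>t\<in>states. walks 1 b t) = 0 then 0 else 1)"
      "\<And>n. n > 0 \<Longrightarrow> poly E (real n) = real (\<Sum>t\<in>states. walks n (n * b) t)"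
    using walks_polynomial[of b] by blast
  show ?thesis
  proof (intro exI conjI allI impI)
    show "nonneg_coeffs E"
      by (rule E(1))
    show "poly E 0 = (if int_points 1 = {} then 0 else 1)"
      by (simp only: E(2) empty)
    show "finite (int_points n)" "poly E (real n) = real (card (int_points n))" if "n > 0" for n
      using fin[OF that] E(3)[OF that] by (simp_all only: card[OF that])
  qed
qed

end

section \<open>From integer points back to the real polytope\<close>

lemma gt_entry_mono:
  assumes "x \<in> skew_GT k m y z" and "i \<in> {1..k}" and "j \<le> m + 1"
  shows "gt_entry m y z x i 0 \<le> gt_entry m y z x i j"
  using assms(3)
proof (induction j)
  case (Suc j)
  then have "gt_entry m y z x i j \<le> gt_entry m y z x i (j + 1)"
    using assms(1,2) by (auto simp: skew_GT_def)
  with Suc show ?case by simp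
qed simp

lemma skew_GT_nonneg:
  assumes "x \<in> skew_GT k m y z" and "p \<in> gt_index k m"
  shows "0 \<le> x p"
proof -
  obtain i j where p: "p = (i, j)" "i \<in> {1..k}" "j \<in> {1..m}"
    using assms(2) by (auto simp: gt_index_def)
  have "0 \<le> gt_entry m y z x i 0"
    by (simp add: gt_entry_def)
  also have "\<dots> \<le> gt_entry m y z x i j"
    using gt_entry_mono[OF assms(1) p(2)] p(3) by simp
  finally show ?thesis
    using p by (simp add: gt_entry_def)
qed

interpretation partial_sums: gt_shape k m "partial_sum y" "partial_sum z" for k m y z
  by unfold_locales (auto simp: mono_def partial_sum_def intro!: sum_mono2)

lemma int_points_iff_skew_GT:
  assumes n: "n > 0" and X: "X \<in> extensional (gt_index k m)"
  shows "X \<in> partial_sums.int_points k m y z n \<longleftrightarrow>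
    (\<lambda>p\<in>gt_index k m. real (X p) / real n) \<in> skew_GT k m y z"
proof -
  have "gt_entry m y z (\<lambda>p\<in>gt_index k m. real (X p) / real n) i j =
      real (partial_sums.int_entry m y z n X i j) / real n" if "i \<in> {1..k}" "j \<le> m + 1" for i j
    using that n by (auto simp: gt_entry_def partial_sums.int_entry_def gt_index_def)
  then show ?thesis
    using X n by (auto simp: partial_sums.int_points_def skew_GT_def PiE_iff divide_le_cancel
      Ball_def atLeast0AtMost simp del: of_nat_Suc)
qed

lemma dilate_skew_GT_lattice:
  assumes n: "n > 0"
  shows "dilate (gt_index k m) n (skew_GT k m y z) \<inter> lattice (gt_index k m) =
    (\<lambda>X. \<lambda>p\<in>gt_index k m. real (X p)) ` partial_sums.int_points k m y z n" (is "?L = ?f ` ?P")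
proof (intro equalityI subsetI)
  fix x assume x: "x \<in> ?L"
  then obtain w where w: "w \<in> skew_GT k m y z" "x = (\<lambda>p\<in>gt_index k m. real n * w p)"
    by (auto simp: dilate_def)
  have ext: "w \<in> extensional (gt_index k m)"
    using w(1) by (simp add: skew_GT_def)
  let ?X = "\<lambda>p\<in>gt_index k m. nat \<lfloor>x p\<rfloor>"
  have X: "real (?X p) = x p" if "p \<in> gt_index k m" for p
  proof -
    have "x p \<in> \<int>" "0 \<le> x p"
      using x that skew_GT_nonneg[OF w(1) that] by (auto simp: Defs.lattice_def w(2) PiE_iff)
    then show ?thesis
      using that by (auto elim!: Ints_cases)
  qed
  have "w = (\<lambda>p\<in>gt_index k m. real (?X p) / real n)"
  proof
    fix p show "w p = (\<lambda>p\<in>gt_index k m. real (?X p) / real n) p"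
      using X[of p] w(2) n by (cases "p \<in> gt_index k m") (auto simp: extensional_arb[OF ext])
  qed
  then have "?X \<in> ?P"
    using w(1) int_points_iff_skew_GT[OF n, of ?X] by simp
  moreover have "x = ?f ?X"
  proof
    fix p show "x p = ?f ?X p"
      using X[of p] w(2) by (cases "p \<in> gt_index k m") auto
  qed
  ultimately show "x \<in> ?f ` ?P"
    by blast
next
  fix x assume "x \<in> ?f ` ?P"
  then obtain X where X: "X \<in> ?P" "x = ?f X"
    by blast
  then have "(\<lambda>p\<in>gt_index k m. real (X p) / real n) \<in> skew_GT k m y z"
    using int_points_iff_skew_GT[OF n, of X] by (auto simp: partial_sums.int_points_def PiE_iff)
  moreover have "x = (\<lambda>p\<in>gt_index k m. real n * (\<lambda>p\<in>gt_index k m. real (X p) / real n) p)"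
    using n by (auto simp: X(2))
  ultimately have "x \<in> dilate (gt_index k m) n (skew_GT k m y z)"
    unfolding dilate_def by blast
  then show "x \<in> ?L"
    by (simp add: X(2) Defs.lattice_def PiE_iff)
qed

text \<open>Rounding down preserves all inequalities and fixes the integral boundary, so a real
  point yields an integer point. This settles n = 0, where the dilate detects real points while the
  constant term detects integer ones.\<close>

lemma skew_GT_empty_iff: "skew_GT k m y z = {} \<longleftrightarrow> partial_sums.int_points k m y z 1 = {}"
proof
  show "partial_sums.int_points k m y z 1 = {}" if "skew_GT k m y z = {}"
    using dilate_skew_GT_lattice[of 1 k m y z] that by (simp add: dilate_def)
  show "skew_GT k m y z = {}" if empty: "partial_sums.int_points k m y z 1 = {}"
  proof (rule ccontr)
    assume "skew_GT k m y z \<noteq> {}"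
    then obtain w where w: "w \<in> skew_GT k m y z"
      by blast
    let ?X = "\<lambda>p\<in>gt_index k m. nat \<lfloor>w p\<rfloor>"
    have "partial_sums.int_entry m y z 1 ?X i j = nat \<lfloor>gt_entry m y z w i j\<rfloor>"
      if "i \<in> {1..k}" "j \<le> m + 1" for i j
      using that by (auto simp: gt_entry_def partial_sums.int_entry_def gt_index_def)
    then have "?X \<in> partial_sums.int_points k m y z 1"
      using w by (auto simp: partial_sums.int_points_def skew_GT_def PiE_iff intro!: nat_mono floor_mono)
    with empty show False by blast
  qed
qed

theorem theorem3p5:
  fixes k m :: nat and y z :: "nat \<Rightarrow> nat"
  assumes "k \<ge> 1" and "m \<ge> 1"
  shows "ehrhart_positive (gt_index k m) (skew_GT k m y z)"
proof -
  let ?I = "gt_index k m" and ?Q = "skew_GT k m y z" and ?P = "partial_sums.int_points k m y z"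
  have mono: "partial_sum v i \<le> partial_sum v k" if "i \<in> {1..k}" for v i
    using that unfolding partial_sum_def by (intro sum_mono2) auto
  \<comment> \<open>A common bound for both boundary columns; it becomes the number of
    blocks.\<close>
  have "\<And>i. i \<in> {1..k} \<Longrightarrow> partial_sum y i \<le> partial_sum y k + partial_sum z k \<and>
      partial_sum z i \<le> partial_sum y k + partial_sum z k"
    using mono[of _ y] mono[of _ z] by (meson trans_le_add1 trans_le_add2)
  from partial_sums.int_points_polynomial[OF this]
  obtain E where E: "nonneg_coeffs E" "poly E 0 = (if ?P 1 = {} then 0 else 1)"
      "\<And>n. n > 0 \<Longrightarrow> finite (?P n)" "\<And>n. n > 0 \<Longrightarrow> poly E (real n) = real (card (?P n))"
    by metis
  have "finite (dilate ?I n ?Q \<inter> lattice ?I) \<and> poly E (real n) = real (card (dilate ?I n ?Q \<inter> lattice ?I))" for n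
  proof (cases "n = 0")
    case True
    have "dilate ?I 0 ?Q = (if ?Q = {} then {} else {\<lambda>p\<in>?I. 0})"
      by (auto simp: dilate_def)
    then have "dilate ?I 0 ?Q \<inter> lattice ?I = (if ?Q = {} then {} else {\<lambda>p\<in>?I. 0})"
      by (auto simp: Defs.lattice_def)
    then show ?thesis
      using True E(2) skew_GT_empty_iff[of k m y z] by simp
  next
    case False
    then have n: "n > 0" by simp
    have "inj_on (\<lambda>X. \<lambda>p\<in>?I. real (X p)) (?P n)"
    proof (rule inj_onI)
      fix X X' assume X: "X \<in> ?P n" "X' \<in> ?P n" and eq: "(\<lambda>p\<in>?I. real (X p)) = (\<lambda>p\<in>?I. real (X' p))"
      show "X = X'"
      proof (rule extensionalityI[of _ ?I])
        show "X p = X' p" if "p \<in> ?I" for p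
          using fun_cong[OF eq, of p] that by simp
      qed (use X in \<open>auto simp: partial_sums.int_points_def PiE_iff\<close>)
    qed
    then show ?thesis
      unfolding dilate_skew_GT_lattice[OF n] using E(3,4)[OF n] by (simp add: card_image)
  qed
  with E(1) show ?thesis
    unfolding ehrhart_positive_def is_ehrhart_polynomial_def nonneg_coeffs_def by blast
qed

end
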